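(* Let $V$ be a group-like set. If the category $\mathcal{M}_V$ has weak amalgamation, then there is a non-meager conjugacy class in $\mathrm{Homeo}(2^{\mathbb{N}},\mu_V)$.
   Context: All measures are Borel probability measures; $2^{\mathbb{N}}$ is the Cantor space. A measure is full if it is positive on every nonempty open set; the clopen values set of $\mu$ is $V_\mu=\{\mu(U): U\text{ clopen}\}$. A full measure $\mu$ on $2^{\mathbb{N}}$ is good if whenever $U,W$ are clopen with $\mu(U)<\mu(W)$, there is a clopen $W'\subseteq W$ with $\mu(W')=\mu(U)$. A set $V$ is group-like if it is countably infinite, $\{0,1\}\subseteq V\subseteq[0,1]$, and $V+\mathbb{Z}$ is an additive subgroup of $\mathbb{R}$. For group-like $V$, $\mu_V$ denotes the good measure on $2^{\mathbb{N}}$ with clopen values set $V$ (it exists and is unique up to homeomorphism). $\mathrm{Homeo}(2^{\mathbb{N}},\mu_V)$ is the Polish group (compact-open topology) of homeomorphisms of $2^{\mathbb{N}}$ preserving $\mu_V$. A clopen partition is a finite partition of $2^{\mathbb{N}}$ into nonempty clopen sets. For clopen partitions $P,R$, a $\mu_V$-morphism $R\to P$ is a surjection $p\colon R\to P$ with $\mu_V(x)=\sum_{y\in p^{-1}(\{x\})}\mu_V(y)$ for all $x\in P$. The category $\mathcal{M}_V$: objects are matrices $A=(a_{p,p'})_{p,p'\in P}$ with entries in $V$, indexed by a clopen partition $P=P_A$ of $2^{\mathbb{N}}$, such that $\sum_{p'\in P}a_{p,p'}=\sum_{p'\in P}a_{p',p}=\mu_V(p)$ for all $p\in P$ (so all entries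 sum to $1$). A morphism from $B=(b_{q,q'})_{q,q'\in Q}$ to $A=(a_{p,p'})_{p,p'\in P}$ is a $\mu_V$-morphism $f\colon Q\to P$ such that $a_{p,p'}=\sum_{q\in f^{-1}(p),\,q'\in f^{-1}(p')}b_{q,q'}$ for all $p,p'\in P$. A category $\mathcal{K}$ has weak amalgamation if for every object $A$ there is a morphism $p\colon A'\to A$ such that for any morphisms $r_i\colon B_i\to A'$ ($i=0,1$) there are an object $C$ and morphisms $s_i\colon C\to B_i$ ($i=0,1$) with $p\circ r_0\circ s_0=p\circ r_1\circ s_1$. *)

theory Defs
  imports "HOL-Probability.Probability"
begin

section \<open>Categories and weak amalgamation\<close>

text \<open>
  In \<open>cmp K a b c g f\<close> the objects \<open>a\<close>, \<open>b\<close>, \<open>c\<close> are such that \<open>f\<close> goes from \<open>a\<close> to \<open>b\<close> and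
  \<open>g\<close> from \<open>b\<close> to \<open>c\<close>. They are arguments because arrows do not carry their source and target.
\<close>

record ('o, 'm) category =
  ob :: "'o set"
  hom :: "'o \<Rightarrow> 'o \<Rightarrow> 'm set"
  ident :: "'o \<Rightarrow> 'm"
  cmp :: "'o \<Rightarrow> 'o \<Rightarrow> 'o \<Rightarrow> 'm \<Rightarrow> 'm \<Rightarrow> 'm"

locale category_laws =
  fixes K :: "('o, 'm) category"
  assumes ident_hom: "a \<in> ob K \<Longrightarrow> ident K a \<in> hom K a a"
    and cmp_hom: "\<lbrakk>a \<in> ob K; b \<in> ob K; c \<in> ob K; f \<in> hom K a b; g \<in> hom K b c\<rbrakk>
      \<Longrightarrow> cmp K a b c g f \<in> hom K a c"
    and cmp_ident_right: "\<lbrakk>a \<in> ob K; b \<in> ob K; f \<in> hom K a b\<rbrakk> \<Longrightarrow> cmp K a a b f (ident K a) = f"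
    and cmp_ident_left: "\<lbrakk>a \<in> ob K; b \<in> ob K; f \<in> hom K a b\<rbrakk> \<Longrightarrow> cmp K a b b (ident K b) f = f"
    and cmp_assoc: "\<lbrakk>a \<in> ob K; b \<in> ob K; c \<in> ob K; d \<in> ob K;
        f \<in> hom K a b; g \<in> hom K b c; h \<in> hom K c d\<rbrakk>
      \<Longrightarrow> cmp K a b d (cmp K b c d h g) f = cmp K a c d h (cmp K a b c g f)"

definition weak_amalgamation :: "('o, 'm) category \<Rightarrow> bool" where
  "weak_amalgamation K \<longleftrightarrow>
     (\<forall>A\<in>ob K. \<exists>A'\<in>ob K. \<exists>p\<in>hom K A' A.
        \<forall>B0\<in>ob K. \<forall>B1\<in>ob K. \<forall>r0\<in>hom K B0 A'. \<forall>r1\<in>hom K B1 A'.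
          \<exists>C\<in>ob K. \<exists>s0\<in>hom K C B0. \<exists>s1\<in>hom K C B1.
            cmp K C A' A p (cmp K C B0 A' r0 s0) = cmp K C A' A p (cmp K C B1 A' r1 s1))"


section \<open>Good measures on the Cantor space\<close>

text \<open>The library topology on \<open>nat \<Rightarrow> bool\<close> is the product topology, with \<open>bool\<close> discrete.\<close>

type_synonym cantor = "nat \<Rightarrow> bool"

definition clopen :: "'a::topological_space set \<Rightarrow> bool" where
  "clopen U \<longleftrightarrow> open U \<and> closed U"

definition borel_prob :: "'a::topological_space measure \<Rightarrow> bool" where
  "borel_prob \<mu> \<longleftrightarrow> prob_space \<mu> \<and> sets \<mu> = sets borel"

definition full_measure :: "'a::topological_space measure \<Rightarrow> bool" where
  "full_measure \<mu> \<longleftrightarrow> (\<forall>U. open U \<and> U \<noteq> {} \<longrightarrow> measure \<mu> U > 0)"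

definition clopen_values :: "'a::topological_space measure \<Rightarrow> real set" where
  "clopen_values \<mu> = {measure \<mu> U | U. clopen U}"

definition good_measure :: "cantor measure \<Rightarrow> bool" where
  "good_measure \<mu> \<longleftrightarrow> borel_prob \<mu> \<and> full_measure \<mu> \<and>
     (\<forall>U W. clopen U \<and> clopen W \<and> measure \<mu> U < measure \<mu> W \<longrightarrow>
        (\<exists>W'. clopen W' \<and> W' \<subseteq> W \<and> measure \<mu> W' = measure \<mu> U))"

definition additive_subgroup_real :: "real set \<Rightarrow> bool" where
  "additive_subgroup_real G \<longleftrightarrow> 0 \<in> G \<and> (\<forall>x\<in>G. \<forall>y\<in>G. x + y \<in> G) \<and> (\<forall>x\<in>G. - x \<in> G)"

definition group_like :: "real set \<Rightarrow> bool" where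
  "group_like V \<longleftrightarrow> countable V \<and> infinite V \<and> {0, 1} \<subseteq> V \<and> V \<subseteq> {0..1} \<and>
     additive_subgroup_real {v + k | v k. v \<in> V \<and> k \<in> \<int>}"


section \<open>The category of measure matrices\<close>

definition clopen_partition :: "'a::topological_space set set \<Rightarrow> bool" where
  "clopen_partition P \<longleftrightarrow> finite P \<and> partition_on UNIV P \<and> (\<forall>x\<in>P. clopen x)"

text \<open>Morphisms are extensional, so that their equality is equality of maps on the source
  partition.\<close>

definition measure_morphism ::
  "cantor measure \<Rightarrow> cantor set set \<Rightarrow> cantor set set \<Rightarrow> (cantor set \<Rightarrow> cantor set) set" where
  "measure_morphism \<mu> R P =
     {p \<in> R \<rightarrow>\<^sub>E P. p ` R = P \<and>
        (\<forall>x\<in>P. measure \<mu> x = (\<Sum>y\<in>{y\<in>R. p y = x}. measure \<mu> y))}"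

text \<open>An object is a pair of an index partition and an extensional matrix.\<close>

type_synonym cantor_matrix = "cantor set set \<times> (cantor set \<times> cantor set \<Rightarrow> real)"

definition measure_matrices :: "cantor measure \<Rightarrow> real set \<Rightarrow> cantor_matrix set" where
  "measure_matrices \<mu> V =
     {(P, a). clopen_partition P \<and> a \<in> P \<times> P \<rightarrow>\<^sub>E V \<and>
        (\<forall>p\<in>P. (\<Sum>p'\<in>P. a (p, p')) = measure \<mu> p \<and> (\<Sum>p'\<in>P. a (p', p)) = measure \<mu> p)}"

definition matrix_morphisms ::
  "cantor measure \<Rightarrow> cantor_matrix \<Rightarrow> cantor_matrix \<Rightarrow> (cantor set \<Rightarrow> cantor set) set" where
  "matrix_morphisms \<mu> = (\<lambda>(Q, b) (P, a).
     {f \<in> measure_morphism \<mu> Q P.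
        \<forall>p\<in>P. \<forall>p'\<in>P. a (p, p') = (\<Sum>q\<in>{q\<in>Q. f q = p}. \<Sum>q'\<in>{q'\<in>Q. f q' = p'}. b (q, q'))})"

definition matrix_category ::
  "cantor measure \<Rightarrow> real set \<Rightarrow> (cantor_matrix, cantor set \<Rightarrow> cantor set) category" where
  "matrix_category \<mu> V =
     \<lparr> ob = measure_matrices \<mu> V,
       hom = matrix_morphisms \<mu>,
       ident = (\<lambda>A. restrict id (fst A)),
       cmp = (\<lambda>A B C g f. compose (fst A) g f) \<rparr>"

lemma sum_fibre:
  fixes h :: "'x \<Rightarrow> real"
  assumes "finite R" "f ` R = Q"
  shows "(\<Sum>q\<in>{q\<in>Q. g q = p}. \<Sum>y\<in>{y\<in>R. f y = q}. h y) = (\<Sum>y\<in>{y\<in>R. g (f y) = p}. h y)"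
proof -
  have "(\<Sum>q\<in>{q\<in>Q. g q = p}. \<Sum>y\<in>{y\<in>R. f y = q}. h y)
      = (\<Sum>q\<in>{q\<in>Q. g q = p}. \<Sum>y\<in>{y\<in>{y\<in>R. g (f y) = p}. f y = q}. h y)"
    by (intro sum.cong refl) auto
  also have "\<dots> = (\<Sum>y\<in>{y\<in>R. g (f y) = p}. h y)"
    by (rule sum.group) (use assms in auto)
  finally show ?thesis .
qed

lemma matrix_category_laws: "category_laws (matrix_category \<mu> V)"
proof
  fix A assume "A \<in> ob (matrix_category \<mu> V)"
  then obtain P a where [simp]: "A = (P, a)" by (cases A) auto
  have "{y \<in> P. restrict id P y = x} = {x}" if "x \<in> P" for x
    using that by auto
  then show "ident (matrix_category \<mu> V) A \<in> hom (matrix_category \<mu> V) A A"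
    by (auto simp: matrix_category_def matrix_morphisms_def measure_morphism_def)
next
  fix A B C f g
  assume "A \<in> ob (matrix_category \<mu> V)" "B \<in> ob (matrix_category \<mu> V)" "C \<in> ob (matrix_category \<mu> V)"
    and fg: "f \<in> hom (matrix_category \<mu> V) A B" "g \<in> hom (matrix_category \<mu> V) B C"
  moreover obtain R c Q b P a where [simp]: "A = (R, c)" "B = (Q, b)" "C = (P, a)"
    by (cases A, cases B, cases C) auto
  ultimately have fin: "finite R" "finite Q"
    by (auto simp: matrix_category_def measure_matrices_def clopen_partition_def)
  have f: "f \<in> R \<rightarrow>\<^sub>E Q" "f ` R = Q" "\<And>x. x \<in> Q \<Longrightarrow> measure \<mu> x = (\<Sum>y\<in>{y\<in>R. f y = x}. measure \<mu> y)"
    "\<And>q q'. q \<in> Q \<Longrightarrow> q' \<in> Q \<Longrightarrow>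
      b (q, q') = (\<Sum>r\<in>{r\<in>R. f r = q}. \<Sum>r'\<in>{r'\<in>R. f r' = q'}. c (r, r'))"
    and g: "g \<in> Q \<rightarrow>\<^sub>E P" "g ` Q = P" "\<And>x. x \<in> P \<Longrightarrow> measure \<mu> x = (\<Sum>y\<in>{y\<in>Q. g y = x}. measure \<mu> y)"
    "\<And>p p'. p \<in> P \<Longrightarrow> p' \<in> P \<Longrightarrow>
      a (p, p') = (\<Sum>q\<in>{q\<in>Q. g q = p}. \<Sum>q'\<in>{q'\<in>Q. g q' = p'}. b (q, q'))"
    using fg by (auto simp: matrix_category_def matrix_morphisms_def measure_morphism_def)
  have fib: "{y \<in> R. compose R g f y = x} = {y \<in> R. g (f y) = x}" for x
    by (auto simp: compose_def)
  have "measure \<mu> x = (\<Sum>y\<in>{y\<in>R. compose R g f y = x}. measure \<mu> y)" if "x \<in> P" for x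
    using g(3)[OF that] f(3) sum_fibre[OF fin(1) f(2), where g = g and p = x and h = "measure \<mu>"] by (simp add: fib)
  moreover have "a (p, p') = (\<Sum>q\<in>{q\<in>R. compose R g f q = p}. \<Sum>q'\<in>{q'\<in>R. compose R g f q' = p'}. c (q, q'))"
    if "p \<in> P" "p' \<in> P" for p p'
  proof -
    have "a (p, p') = (\<Sum>q\<in>{q\<in>Q. g q = p}. \<Sum>q'\<in>{q'\<in>Q. g q' = p'}.
        \<Sum>r\<in>{r\<in>R. f r = q}. \<Sum>r'\<in>{r'\<in>R. f r' = q'}. c (r, r'))"
      using g(4)[OF that] f(4) by simp
    also have "\<dots> = (\<Sum>q\<in>{q\<in>Q. g q = p}. \<Sum>r\<in>{r\<in>R. f r = q}. \<Sum>q'\<in>{q'\<in>Q. g q' = p'}.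
        \<Sum>r'\<in>{r'\<in>R. f r' = q'}. c (r, r'))"
      by (intro sum.cong refl sum.swap)
    also have "\<dots> = (\<Sum>r\<in>{r\<in>R. g (f r) = p}. \<Sum>r'\<in>{r'\<in>R. g (f r') = p'}. c (r, r'))"
      by (simp add: sum_fibre[OF fin(1) f(2)])
    finally show ?thesis by (simp add: fib)
  qed
  moreover have "compose R g f \<in> R \<rightarrow>\<^sub>E P" "compose R g f ` R = P"
    using f(1,2) g(1,2) by (auto simp: compose_def)
  ultimately show "cmp (matrix_category \<mu> V) A B C g f \<in> hom (matrix_category \<mu> V) A C"
    by (simp add: matrix_category_def matrix_morphisms_def measure_morphism_def)
qed (auto simp: matrix_category_def matrix_morphisms_def measure_morphism_def compose_def
       fun_eq_iff PiE_iff extensional_def split: prod.splits)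


section \<open>Measure preserving homeomorphisms\<close>

definition homeo_group :: "cantor measure \<Rightarrow> (cantor \<Rightarrow> cantor) set" where
  "homeo_group \<mu> = {f. (\<exists>g. homeomorphism UNIV UNIV f g) \<and> distr \<mu> \<mu> f = \<mu>}"

definition compact_open_topology ::
  "('a::topological_space \<Rightarrow> 'b::topological_space) set \<Rightarrow> ('a \<Rightarrow> 'b) topology" where
  "compact_open_topology F =
     subtopology (topology_generated_by {{f. f ` K \<subseteq> U} | K U. compact K \<and> open U}) F"

lemma topspace_compact_open_topology: "topspace (compact_open_topology F) = F"
proof -
  have "UNIV \<in> {{f :: 'a \<Rightarrow> 'b. f ` K \<subseteq> U} | K U. compact K \<and> open U}"
    by (auto intro!: exI[of _ "{}"])
  then show ?thesis
    unfolding compact_open_topology_def topspace_subtopology topology_generated_by_topspace by blast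
qed

definition homeo_conjugacy_class :: "cantor measure \<Rightarrow> (cantor \<Rightarrow> cantor) \<Rightarrow> (cantor \<Rightarrow> cantor) set" where
  "homeo_conjugacy_class \<mu> f = {h \<circ> f \<circ> inv h | h. h \<in> homeo_group \<mu>}"

definition nowhere_dense_in :: "'a topology \<Rightarrow> 'a set \<Rightarrow> bool" where
  "nowhere_dense_in X S \<longleftrightarrow> S \<subseteq> topspace X \<and> X interior_of (X closure_of S) = {}"

definition meager_in :: "'a topology \<Rightarrow> 'a set \<Rightarrow> bool" where
  "meager_in X S \<longleftrightarrow> (\<exists>\<N>. countable \<N> \<and> (\<forall>N\<in>\<N>. nowhere_dense_in X N) \<and> S = \<Union>\<N>)"

end

theory Submission
  imports Defs
begin

text \<open>
  Goodness of \<open>\<mu>\<close> turns a finite partial isomorphism, that is a pair of clopen partitions whose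
  corresponding pieces have equal measure, into a measure preserving homeomorphism by back and
  forth. Hence every matrix \<open>A\<close> over \<open>P\<close> is the matrix \<open>\<mu> (p \<inter> f -` p')\<close> of some \<open>f\<close>; the sets \<open>N A\<close>
  of all such \<open>f\<close> form a basis of the topology, and a morphism from \<open>B\<close> to \<open>A\<close> yields a
  homeomorphism that conjugates \<open>N B\<close> into \<open>N A\<close>. Under this dictionary weak amalgamation says
  that for every open subgroup \<open>U\<close> each nonempty open set contains a nonempty open \<open>W\<close> such that any
  two nonempty open subsets of \<open>W\<close> are linked by conjugation with some element of \<open>U\<close>. By the Baire
  category theorem there is then an \<open>f\<close> whose \<open>U\<close>-orbit is dense in a neighbourhood of \<open>f\<close>, for all
  basic \<open>U\<close> simultaneously. If the conjugacy class of \<open>f\<close> were covered by countably many nowhere dense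
  sets, then by Baire again the closure of one of them would contain \<open>conjugate h f\<close> for all \<open>h\<close>
  in a nonempty open set, hence a translate of such a dense orbit.
\<close>

section \<open>Clopen subsets of the Cantor space\<close>

text \<open>An ultrametric in disguise: the classes of \<open>agree n\<close> are the cylinders of
  length \<open>n\<close>, and continuity, clopenness and closeness of maps are all expressed
  through them.\<close>

definition agree :: "nat \<Rightarrow> cantor \<Rightarrow> cantor \<Rightarrow> bool" where
  "agree n x y \<longleftrightarrow> (\<forall>k<n. x k = y k)"

lemma agree_refl [simp]: "agree n x x"
  and agree_0 [simp]: "agree 0 x y"
  and agree_sym: "agree n x y \<Longrightarrow> agree n y x"
  and agree_trans: "agree n x y \<Longrightarrow> agree n y z \<Longrightarrow> agree n x z"
  and agree_mono: "agree n x y \<Longrightarrow> m \<le> n \<Longrightarrow> agree m x y"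
  by (auto simp: agree_def)

lemma agree_Suc: "agree (Suc n) x y \<longleftrightarrow> agree n x y \<and> x n = y n"
  by (auto simp: agree_def less_Suc_eq)

lemma agree_imp_eq: "(\<And>n. agree n x y) \<Longrightarrow> x = y"
  by (auto simp: agree_def)

lemma open_coordinate: "open {x :: cantor. x k \<in> S}"
proof -
  have "continuous_on UNIV (\<lambda>x :: cantor. x k)" by simp
  moreover have "open S" by (rule discrete_topology_class.open_discrete)
  ultimately have "open ((\<lambda>x :: cantor. x k) -` S)"
    by (simp add: open_vimage)
  then show ?thesis by (simp add: vimage_def)
qed

lemma clopen_coordinate: "clopen {x :: cantor. x k}"
  using open_coordinate[of k "{True}"] open_coordinate[of k "{False}"]
  by (simp add: clopen_def closed_def Compl_eq)

lemma open_agree: "open {y. agree n x y}"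
proof -
  have "{y. agree n x y} = (\<Inter>k\<in>{..<n}. {y. y k \<in> {x k}})"
    by (auto simp: agree_def)
  then show ?thesis
    by (simp only:) (intro open_INT ballI open_coordinate finite_lessThan)
qed

lemma open_agree_ball:
  assumes "open U" "x \<in> U"
  obtains n where "{y. agree n x y} \<subseteq> U"
proof -
  have "openin (product_topology (\<lambda>i. euclidean) UNIV) U"
    using assms by (simp add: open_fun_def)
  from product_topology_open_contains_basis[OF this assms(2)]
  obtain X where X: "x \<in> (\<Pi>\<^sub>E i\<in>UNIV. X i)" "finite {i. X i \<noteq> UNIV}" "(\<Pi>\<^sub>E i\<in>UNIV. X i) \<subseteq> U"
    by auto
  obtain n where n: "\<forall>i\<in>{i. X i \<noteq> UNIV}. i < n"
    using X(2) by (metis finite_nat_set_iff_bounded)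
  have "y \<in> U" if "agree n x y" for y
  proof -
    have "y i \<in> X i" for i
    proof (cases "X i = UNIV")
      case False
      then have "i < n" using n by blast
      then have "y i = x i" using that by (simp add: agree_def)
      moreover have "x i \<in> X i" using X(1) by (simp add: PiE_iff)
      ultimately show ?thesis by simp
    qed simp
    then have "y \<in> (\<Pi>\<^sub>E i\<in>UNIV. X i)" by (simp add: PiE_UNIV_domain)
    then show ?thesis using X(3) by blast
  qed
  then show ?thesis using that by blast
qed

lemma compact_UNIV_cantor: "compact (UNIV :: cantor set)"
proof -
  have "compact_space (euclidean :: bool topology)"
    by (simp add: compact_space_def finite_imp_compact)
  then have "compact_space (product_topology (\<lambda>i :: nat. euclidean :: bool topology) UNIV)"
    by (simp add: compact_space_product_topology)
  then show ?thesis
    by (simp add: euclidean_product_topology compact_space_def)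
qed

text \<open>The Lebesgue number lemma. Two cylinders are nested or disjoint, so the greatest length
  in a finite subcover already serves, without the usual halving of radii.\<close>

lemma compact_open_agree:
  assumes "compact K" "open U" "K \<subseteq> U"
  obtains n where "\<And>x y. x \<in> K \<Longrightarrow> agree n x y \<Longrightarrow> y \<in> U"
proof -
  have "\<forall>x\<in>K. \<exists>n. {y. agree n x y} \<subseteq> U"
    using assms open_agree_ball by (metis subsetD)
  then obtain N where N: "\<And>x. x \<in> K \<Longrightarrow> {y. agree (N x) x y} \<subseteq> U" by metis
  obtain C where C: "C \<subseteq> K" "finite C" "K \<subseteq> (\<Union>x\<in>C. {y. agree (N x) x y})"
    by (rule compactE_image[OF assms(1), of K "\<lambda>x. {y. agree (N x) x y}"])
      (auto simp: open_agree)
  show ?thesis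
  \<comment> \<open>The \<open>0\<close> keeps the maximum defined when \<open>K\<close>, and with
    it \<open>C\<close>, is empty.\<close>
  proof (rule that[of "Max (insert 0 (N ` C))"])
    fix x y assume x: "x \<in> K" and y: "agree (Max (insert 0 (N ` C))) x y"
    obtain z where z: "z \<in> C" "agree (N z) z x" using C(3) x by auto
    have "N z \<le> Max (insert 0 (N ` C))" using z(1) C(2) by auto
    then have "agree (N z) z y" using z(2) y agree_mono agree_trans by blast
    then show "y \<in> U" using N[of z] z(1) C(1) by auto
  qed
qed

text \<open>Compactness of \<open>U\<close> lets membership pass from \<open>x\<close> to every
  \<open>y\<close> in its cylinder; since \<open>agree n\<close> is symmetric, the converse comes
  without an argument for the complement.\<close>

lemma clopenE_agree:
  assumes "clopen (U :: cantor set)"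
  obtains n where "\<And>x y. agree n x y \<Longrightarrow> x \<in> U \<longleftrightarrow> y \<in> U"
proof -
  have "compact U"
    using assms compact_UNIV_cantor compact_Int_closed[of UNIV U] by (simp add: clopen_def)
  then obtain n where "\<And>x y. x \<in> U \<Longrightarrow> agree n x y \<Longrightarrow> y \<in> U"
    using compact_open_agree[of U U] assms by (auto simp: clopen_def)
  then show ?thesis using that agree_sym by blast
qed

lemma finite_clopenE_agree:
  assumes "finite \<C>" "\<And>U. U \<in> \<C> \<Longrightarrow> clopen (U :: cantor set)"
  obtains n where "\<And>U x y. U \<in> \<C> \<Longrightarrow> agree n x y \<Longrightarrow> x \<in> U \<longleftrightarrow> y \<in> U"
proof -
  have "\<exists>n. \<forall>U\<in>\<C>. \<forall>x y. agree n x y \<longrightarrow> (x \<in> U \<longleftrightarrow> y \<in> U)"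
    using assms
  proof (induction rule: finite_induct)
    case (insert U \<C>)
    obtain n where n: "\<forall>U\<in>\<C>. \<forall>x y. agree n x y \<longrightarrow> (x \<in> U \<longleftrightarrow> y \<in> U)"
      using insert by auto
    obtain m where "\<And>x y. agree m x y \<Longrightarrow> x \<in> U \<longleftrightarrow> y \<in> U"
      using clopenE_agree insert.prems by blast
    moreover have "agree m x y" "agree n x y" if "agree (max m n) x y" for x y
      using that agree_mono[of "max m n"] by auto
    ultimately show ?case
      using n by (intro exI[of _ "max m n"]) blast
  qed simp
  then show ?thesis using that by metis
qed

lemma clopenI_agree:
  assumes "\<And>x y. agree n x y \<Longrightarrow> x \<in> U \<longleftrightarrow> y \<in> U"
  shows "clopen U"
proof -
  have U: "W = (\<Union>x\<in>W. {y. agree n x y})" if "\<And>x y. agree n x y \<Longrightarrow> x \<in> W \<longleftrightarrow> y \<in> W" for W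
    using that agree_refl by blast
  have "open (\<Union>x\<in>W. {y. agree n x y})" for W
    by (intro open_UN ballI open_agree)
  then have "open U" "open (- U)"
    using U[of U] U[of "- U"] assms by (metis, metis ComplD ComplI)
  then show ?thesis by (simp add: clopen_def closed_def)
qed

lemma clopen_UNIV [simp]: "clopen UNIV"
  and clopen_Int: "clopen U \<Longrightarrow> clopen W \<Longrightarrow> clopen (U \<inter> W)"
  and clopen_Diff: "clopen U \<Longrightarrow> clopen W \<Longrightarrow> clopen (U - W)"
  by (auto simp: clopen_def)

lemma clopen_UN: "finite I \<Longrightarrow> (\<And>i. i \<in> I \<Longrightarrow> clopen (F i)) \<Longrightarrow> clopen (\<Union>i\<in>I. F i)"
  by (auto simp: clopen_def intro: closed_UN)

text \<open>A clopen set is given by a length \<open>n\<close> and the finite set of length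
  \<open>n\<close> prefixes of its members.\<close>

lemma countable_clopen: "countable {U :: cantor set. clopen U}"
proof (rule countable_subset)
  let ?F = "\<lambda>(n, S). {x :: cantor. map x [0..<n] \<in> S}"
  show "countable (?F ` (UNIV \<times> {S. finite S}))"
    by (intro countable_image countable_SIGMA countable_Collect_finite) auto
  show "{U :: cantor set. clopen U} \<subseteq> ?F ` (UNIV \<times> {S. finite S})"
  proof
    fix U :: "cantor set" assume "U \<in> {U. clopen U}"
    then obtain n where n: "\<And>x y. agree n x y \<Longrightarrow> x \<in> U \<longleftrightarrow> y \<in> U"
      using clopenE_agree by auto
    let ?S = "(\<lambda>x. map x [0..<n]) ` U"
    have "?S \<subseteq> {l. set l \<subseteq> UNIV \<and> length l = n}" by auto
    then have "finite ?S" by (rule finite_subset) (rule finite_lists_length_eq, simp)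
    moreover have "U = ?F (n, ?S)"
    proof (intro equalityI subsetI)
      fix x assume "x \<in> ?F (n, ?S)"
      then obtain y where "y \<in> U" "map x [0..<n] = map y [0..<n]" by auto
      then show "x \<in> U" using n[of x y] by (auto simp: agree_def)
    qed auto
    ultimately show "U \<in> ?F ` (UNIV \<times> {S. finite S})" by blast
  qed
qed

section \<open>Cylinder partitions, uniform continuity and Borel sets\<close>

definition cell :: "nat \<Rightarrow> cantor \<Rightarrow> cantor set" where
  "cell n x = {y. agree n x y}"

definition cells :: "nat \<Rightarrow> cantor set set" where
  "cells n = range (cell n)"

lemma mem_cell [simp]: "y \<in> cell n x \<longleftrightarrow> agree n x y"
  by (simp add: cell_def)

lemma finite_cells: "finite (cells n)"
proof -
  let ?F = "\<lambda>l. {y :: cantor. map y [0..<n] = l}"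
  have "cell n x = ?F (map x [0..<n])" for x
    by (auto simp: agree_def)
  then have "cell n x \<in> ?F ` {l. set l \<subseteq> UNIV \<and> length l = n}" for x
    by (intro image_eqI[where x = "map x [0..<n]"]) auto
  then have "cells n \<subseteq> ?F ` {l. set l \<subseteq> UNIV \<and> length l = n}"
    unfolding cells_def by (rule image_subsetI)
  then show ?thesis
    by (rule finite_subset) (intro finite_imageI finite_lists_length_eq, simp)
qed

lemma clopen_cell: "clopen (cell n x)"
  by (rule clopenI_agree[of n]) (meson agree_sym agree_trans mem_cell)

lemma clopen_cells: "c \<in> cells n \<Longrightarrow> clopen c"
  by (auto simp: cells_def clopen_cell)

lemma cells_agree: "c \<in> cells n \<Longrightarrow> x \<in> c \<Longrightarrow> y \<in> c \<longleftrightarrow> agree n x y"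
  by (auto simp: cells_def agree_def)

lemma clopen_partition_cells: "clopen_partition (cells n)"
proof -
  have "disjoint (cells n)"
  proof (rule disjointI)
    fix c d assume cd: "c \<in> cells n" "d \<in> cells n" "c \<noteq> d"
    have "c = d" if "x \<in> c" "x \<in> d" for x
      using cells_agree[OF cd(1) that(1)] cells_agree[OF cd(2) that(2)] by blast
    then show "c \<inter> d = {}" using cd(3) by blast
  qed
  moreover have "x \<in> cell n x" for x by simp
  then have "{} \<notin> cells n" "\<Union>(cells n) = UNIV"
    unfolding cells_def by (metis empty_iff imageE, blast)
  ultimately show ?thesis
    by (auto simp: clopen_partition_def partition_on_def finite_cells clopen_cells)
qed

lemma clopen_partitionD:
  assumes "clopen_partition P"
  shows "finite P" "disjoint P" "{} \<notin> P" "\<Union>P = UNIV" "\<And>p. p \<in> P \<Longrightarrow> clopen p"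
  using assms by (auto simp: clopen_partition_def partition_on_def)

lemma clopen_partition_ex1:
  assumes "clopen_partition P"
  shows "\<exists>!p. p \<in> P \<and> x \<in> p"
proof -
  obtain p where "p \<in> P" "x \<in> p" using clopen_partitionD(4)[OF assms] by blast
  then show ?thesis using clopen_partitionD(2)[OF assms] by (metis disjointD IntI empty_iff)
qed

lemma clopen_partition_eq:
  "clopen_partition P \<Longrightarrow> p \<in> P \<Longrightarrow> q \<in> P \<Longrightarrow> x \<in> p \<Longrightarrow> x \<in> q \<Longrightarrow> p = q"
  using clopen_partition_ex1[of P x] by blast

text \<open>Uniform continuity: the first \<open>n\<close> coordinates of the image are decided by
  the preimages of \<open>n\<close> coordinate sets, which are clopen and so depend on a common
  number \<open>m\<close> of coordinates.\<close>

lemma continuous_agree: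
  assumes "continuous_on UNIV (f :: cantor \<Rightarrow> cantor)"
  obtains m where "\<And>x y. agree m x y \<Longrightarrow> agree n (f x) (f y)"
proof -
  have "clopen (f -` U)" if "clopen U" for U
    using that assms by (auto simp: clopen_def intro: open_vimage closed_vimage)
  then have "\<And>U. U \<in> (\<lambda>k. f -` {x. x k}) ` {..<n} \<Longrightarrow> clopen U"
    using clopen_coordinate by blast
  then obtain m where m: "\<And>U x y. U \<in> (\<lambda>k. f -` {x. x k}) ` {..<n} \<Longrightarrow> agree m x y \<Longrightarrow> x \<in> U \<longleftrightarrow> y \<in> U"
    using finite_clopenE_agree[of "(\<lambda>k. f -` {x. x k}) ` {..<n}"] by auto
  show ?thesis
  proof (rule that[of m])
    fix x y assume xy: "agree m x y"
    have "f x k = f y k" if "k < n" for k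
      using m[OF imageI xy, of k] that by simp
    then show "agree n (f x) (f y)" by (simp add: agree_def)
  qed
qed

lemma continuousI_agree:
  assumes "\<And>n. \<exists>m. \<forall>x y. agree m x y \<longrightarrow> agree n (f x) (f y)"
  shows "continuous_on UNIV (f :: cantor \<Rightarrow> cantor)"
proof -
  have "open (f -` U)" if "open U" for U
  proof (subst open_subopen, intro ballI)
    fix x assume "x \<in> f -` U"
    then obtain n where n: "{y. agree n (f x) y} \<subseteq> U" using open_agree_ball \<open>open U\<close> by auto
    obtain m where "\<forall>x y. agree m x y \<longrightarrow> agree n (f x) (f y)" using assms by blast
    then show "\<exists>T. open T \<and> x \<in> T \<and> T \<subseteq> f -` U"
      using n by (intro exI[of _ "cell m x"]) (auto simp: cell_def open_agree)
  qed
  then show ?thesis by (simp add: continuous_on_open_vimage)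
qed

text \<open>Lets Borel measures be compared on clopen sets only. An open set is the union of its
  clopen subsets, of which there are countably many.\<close>

lemma sets_borel_clopen: "sets (borel :: cantor measure) = sigma_sets UNIV {U. clopen U}"
proof -
  have "open U \<Longrightarrow> U \<in> sigma_sets UNIV {U. clopen U}" for U :: "cantor set"
  proof -
    assume U: "open U"
    have "U = \<Union>{C. clopen C \<and> C \<subseteq> U}"
    proof (intro equalityI subsetI)
      fix x assume "x \<in> U"
      then obtain n where "{y. agree n x y} \<subseteq> U" using open_agree_ball U by blast
      then have "cell n x \<in> {C. clopen C \<and> C \<subseteq> U}" "x \<in> cell n x"
        using clopen_cell by (auto simp: cell_def)
      then show "x \<in> \<Union>{C. clopen C \<and> C \<subseteq> U}" by blast
    qed auto
    moreover have "countable {C. clopen C \<and> C \<subseteq> U}"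
      by (rule countable_subset[OF _ countable_clopen]) auto
    then have "\<Union>{C. clopen C \<and> C \<subseteq> U} \<in> sigma_sets UNIV {U. clopen U}"
      by (rule sigma_sets_UNION) auto
    ultimately show ?thesis by simp
  qed
  then have "sigma_sets UNIV {U :: cantor set. open U} \<subseteq> sigma_sets UNIV {U. clopen U}"
    by (intro sigma_sets_mono) auto
  moreover have "sigma_sets UNIV {U :: cantor set. clopen U} \<subseteq> sigma_sets UNIV {U. open U}"
    by (intro sigma_sets_mono) (auto simp: clopen_def)
  ultimately show ?thesis by (auto simp: borel_def)
qed

section \<open>Limits of partial isomorphisms\<close>

text \<open>Inclusion suffices: if the first components cover the space and the second ones are
  disjoint, a surjection that realizes \<open>S\<close> maps each first component onto its
  partner.\<close>

definition realizes :: "(cantor \<Rightarrow> cantor) \<Rightarrow> (cantor set \<times> cantor set) set \<Rightarrow> bool" where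
  "realizes f S \<longleftrightarrow> (\<forall>s\<in>S. f ` fst s \<subseteq> snd s)"

definition refines :: "(cantor set \<times> cantor set) set \<Rightarrow> (cantor set \<times> cantor set) set \<Rightarrow> bool" where
  "refines S' S \<longleftrightarrow> (\<forall>s'\<in>S'. \<exists>s\<in>S. fst s' \<subseteq> fst s \<and> snd s' \<subseteq> snd s)"

text \<open>Both sides are bounded: small second components make a limit map well defined and
  continuous, and small first components do the same for its inverse.\<close>

definition mesh :: "nat \<Rightarrow> (cantor set \<times> cantor set) set \<Rightarrow> bool" where
  "mesh n S \<longleftrightarrow> (\<forall>s\<in>S. (\<forall>x\<in>fst s. \<forall>y\<in>fst s. agree n x y) \<and> (\<forall>x\<in>snd s. \<forall>y\<in>snd s. agree n x y))"

lemma refines_refl: "refines S S"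
  by (auto simp: refines_def)

lemma refines_trans: "refines S T \<Longrightarrow> refines T U \<Longrightarrow> refines S U"
  unfolding refines_def by (meson subset_trans)

lemma refines_seq:
  assumes "\<And>n. refines (S (Suc n)) (S n)" "m \<le> n"
  shows "refines (S n) (S m)"
  using assms(2) by (induction rule: dec_induct) (auto intro: refines_refl refines_trans assms(1))

text \<open>Points \<open>y n x\<close> picked from the second components of the nested pieces
  around \<open>x\<close> agree on ever more coordinates, so they converge to a value
  \<open>h x\<close>.\<close>

lemma limit_map:
  assumes ex1: "\<And>n x. \<exists>!s. s \<in> S n \<and> x \<in> fst s"
    and ref: "\<And>n. refines (S (Suc n)) (S n)"
    and mesh: "\<And>n. mesh n (S n)"
    and clopen: "\<And>n s. s \<in> S n \<Longrightarrow> clopen (snd s)"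
    and ne: "\<And>n s. s \<in> S n \<Longrightarrow> fst s \<noteq> {} \<Longrightarrow> snd s \<noteq> {}"
  shows "\<exists>h. \<forall>n. realizes h (S n)"
proof -
  have "\<forall>n x. \<exists>s. s \<in> S n \<and> x \<in> fst s" using ex1 by blast
  then obtain s where s: "\<And>n x. s n x \<in> S n" "\<And>n x. x \<in> fst (s n x)" by metis
  have su: "t = s n x" if "t \<in> S n" "x \<in> fst t" for t n x
    using ex1[of n x] s that by blast
  have "\<forall>n x. \<exists>y. y \<in> snd (s n x)" using ne s by blast
  then obtain y where y: "\<And>n x. y n x \<in> snd (s n x)" by metis
  have sub: "snd (s n x) \<subseteq> snd (s m x)" if mn: "m \<le> n" for m n x
  proof -
    obtain t where t: "t \<in> S m" "fst (s n x) \<subseteq> fst t" "snd (s n x) \<subseteq> snd t"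
      using refines_seq[of S, OF ref mn] s(1)[of n x] unfolding refines_def by blast
    then have "t = s m x" using su s(2) by blast
    then show ?thesis using t by blast
  qed
  \<comment> \<open>Stage \<open>Suc k\<close> is the first whose mesh bound fixes coordinate
    \<open>k\<close>.\<close>
  define h where "h x k = y (Suc k) x k" for x k
  have h: "agree n (h x) (y n x)" for n x
  proof (unfold agree_def, intro allI impI)
    fix k assume "k < n"
    then have "y n x \<in> snd (s (Suc k) x)" using sub y by (meson Suc_leI subsetD)
    then have "agree (Suc k) (y (Suc k) x) (y n x)"
      using mesh[of "Suc k"] y s(1) unfolding mesh_def by blast
    then show "h x k = y n x k" by (simp add: h_def agree_def)
  qed
  have "h x \<in> snd (s n x)" for n x
  proof -
    \<comment> \<open>The limit stays in the piece: membership is decided by \<open>m\<close>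
      coordinates, on which \<open>h x\<close> matches the point chosen at stage
      \<open>max m n\<close>.\<close>
    obtain m where m: "\<And>a b. agree m a b \<Longrightarrow> a \<in> snd (s n x) \<longleftrightarrow> b \<in> snd (s n x)"
      using clopenE_agree[OF clopen[OF s(1)]] by blast
    have "y (max m n) x \<in> snd (s n x)" using sub y by (meson max.cobounded2 subsetD)
    moreover have "agree m (h x) (y (max m n) x)"
      using h agree_mono by (meson max.cobounded1)
    ultimately show ?thesis using m by blast
  qed
  then have "realizes h (S n)" for n
    unfolding realizes_def using su by blast
  then show ?thesis by blast
qed

section \<open>Measure preserving homeomorphisms\<close>

locale good_cantor_measure =
  fixes \<mu> :: "cantor measure"
  assumes good: "good_measure \<mu>"
begin

sublocale prob_space \<mu>
  using good by (simp add: good_measure_def borel_prob_def)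

abbreviation "G \<equiv> homeo_group \<mu>"

lemma sets_eq: "sets \<mu> = sets borel"
  using good by (simp add: good_measure_def borel_prob_def)

lemma space_eq: "space \<mu> = UNIV"
  using sets_eq_imp_space_eq[OF sets_eq] by simp

lemma clopen_in_sets: "clopen U \<Longrightarrow> U \<in> sets \<mu>"
  by (simp add: sets_eq clopen_def)

lemma measure_eq_0: "clopen U \<Longrightarrow> measure \<mu> U = 0 \<Longrightarrow> U = {}"
  using good by (force simp: good_measure_def full_measure_def clopen_def)

section \<open>Cutting clopen sets by goodness\<close>

lemma subset_of_measure:
  assumes "clopen U" "clopen W" "measure \<mu> U \<le> measure \<mu> W"
  obtains W' where "clopen W'" "W' \<subseteq> W" "measure \<mu> W' = measure \<mu> U"
proof (cases "measure \<mu> U = measure \<mu> W")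
  case False
  then show ?thesis using assms good that unfolding good_measure_def by (meson order_le_less)
qed (use assms that in auto)

lemma measure_Diff_clopen:
  "clopen U \<Longrightarrow> clopen W \<Longrightarrow> U \<subseteq> W \<Longrightarrow> measure \<mu> (W - U) = measure \<mu> W - measure \<mu> U"
  by (simp add: finite_measure_Diff clopen_in_sets)

lemma measure_UN_clopen:
  "finite I \<Longrightarrow> (\<And>i. i \<in> I \<Longrightarrow> clopen (F i)) \<Longrightarrow> disjoint_family_on F I \<Longrightarrow>
    measure \<mu> (\<Union>i\<in>I. F i) = (\<Sum>i\<in>I. measure \<mu> (F i))"
  by (intro finite_measure_finite_Union) (auto simp: clopen_in_sets)

text \<open>The pieces are cut off one by one. Since \<open>v j\<close> is the measure of some
  clopen set, goodness places a clopen set of that measure inside \<open>W\<close>, and the other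
  values still sum to the measure of the rest.\<close>

lemma split_clopen:
  assumes "finite I" "clopen W" "\<And>i. i \<in> I \<Longrightarrow> v i \<in> clopen_values \<mu>" "(\<Sum>i\<in>I. v i) = measure \<mu> W"
  obtains Q where "\<And>i. i \<in> I \<Longrightarrow> clopen (Q i)" "\<And>i. i \<in> I \<Longrightarrow> measure \<mu> (Q i) = v i"
    "disjoint_family_on Q I" "(\<Union>i\<in>I. Q i) = W"
proof -
  have "\<exists>Q. (\<forall>i\<in>I. clopen (Q i) \<and> measure \<mu> (Q i) = v i) \<and> disjoint_family_on Q I \<and> (\<Union>i\<in>I. Q i) = W"
    using assms
  proof (induction I arbitrary: W rule: finite_induct)
    case empty
    \<comment> \<open>After the last cut the rest has measure \<open>0\<close>; fullness makes it
      empty, so the pieces exhaust \<open>W\<close>.\<close>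
    then show ?case using measure_eq_0[of W] by (simp add: disjoint_family_on_def)
  next
    case (insert j I)
    obtain U where U: "clopen U" "v j = measure \<mu> U"
      using insert.prems(2)[of j] by (auto simp: clopen_values_def)
    have "0 \<le> v i" if "i \<in> I" for i
      using insert.prems(2)[of i] that by (auto simp: clopen_values_def)
    then have "0 \<le> (\<Sum>i\<in>I. v i)" by (simp add: sum_nonneg)
    then have "measure \<mu> U \<le> measure \<mu> W" using insert U by simp
    then obtain W' where W': "clopen W'" "W' \<subseteq> W" "measure \<mu> W' = v j"
      using subset_of_measure U insert.prems(1) by metis
    have "(\<Sum>i\<in>I. v i) = measure \<mu> (W - W')"
      using insert W' by (simp add: measure_Diff_clopen)
    then obtain Q where Q: "\<forall>i\<in>I. clopen (Q i) \<and> measure \<mu> (Q i) = v i" "disjoint_family_on Q I"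
        "(\<Union>i\<in>I. Q i) = W - W'"
      using insert.IH[OF clopen_Diff[OF insert.prems(1) W'(1)]] insert.prems(2) by (metis insertI2)
    let ?Q = "Q(j := W')"
    have eq: "?Q i = Q i" if "i \<in> I" for i using that insert.hyps by auto
    have "disjoint_family_on ?Q (insert j I)"
      using Q(2,3) insert.hyps unfolding disjoint_family_on_def by (auto split: if_splits)
    moreover have "(\<Union>i\<in>insert j I. ?Q i) = W"
    proof -
      have "(\<Union>i\<in>I. ?Q i) = (\<Union>i\<in>I. Q i)" by (rule SUP_cong) (simp_all add: eq del: fun_upd_apply)
      then have "(\<Union>i\<in>insert j I. ?Q i) = W' \<union> (W - W')"
        unfolding UN_insert by (simp only: fun_upd_same Q(3))
      then show ?thesis using W'(2) by (simp only: Un_Diff_cancel Un_absorb1)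
    qed
    moreover have "\<forall>i\<in>insert j I. clopen (?Q i) \<and> measure \<mu> (?Q i) = v i"
      using Q(1) W' by auto
    ultimately show ?case by blast
  qed
  then show ?thesis using that by blast
qed

section \<open>Group structure\<close>

text \<open>Clopen sets form an intersection-stable generator of the Borel sets, so preserving their
  measure determines the whole image measure.\<close>

lemma homeo_groupI:
  assumes cont: "continuous_on UNIV f" "continuous_on UNIV g"
    and inv: "\<And>x. g (f x) = x" "\<And>x. f (g x) = x"
    and meas: "\<And>U. clopen U \<Longrightarrow> measure \<mu> (f -` U) = measure \<mu> U"
  shows "f \<in> G"
proof -
  have "homeomorphism UNIV UNIV f g"
    unfolding homeomorphism_def using cont inv by (auto simp: surj_def) metis+
  moreover have f: "f \<in> measurable \<mu> \<mu>"
    using borel_measurable_continuous_onI[OF cont(1)] by (simp add: sets_eq cong: measurable_cong_sets)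
  have "distr \<mu> \<mu> f = \<mu>"
  proof (rule measure_eqI_generator_eq[where E = "{U. clopen U}" and \<Omega> = UNIV and A = "\<lambda>_. UNIV"])
    show "Int_stable {U :: cantor set. clopen U}"
      by (auto simp: Int_stable_def clopen_Int)
    show "emeasure (distr \<mu> \<mu> f) U = emeasure \<mu> U" if "U \<in> {U. clopen U}" for U
      using that f meas by (simp add: emeasure_distr clopen_in_sets space_eq emeasure_eq_measure)
  qed (auto simp: sets_eq sets_borel_clopen emeasure_distr[OF f])
  ultimately show ?thesis by (auto simp: homeo_group_def)
qed

lemma homeo_group_homeomorphism:
  assumes "f \<in> G" shows "homeomorphism UNIV UNIV f (inv f)"
proof -
  obtain g where g: "homeomorphism UNIV UNIV f g" using assms by (auto simp: homeo_group_def)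
  then have "inv f = g" by (intro inv_equality) (auto simp: homeomorphism_def)
  then show ?thesis using g by simp
qed

lemma homeo_group_continuous: "f \<in> G \<Longrightarrow> continuous_on UNIV f"
  and homeo_group_inv_f [simp]: "f \<in> G \<Longrightarrow> inv f (f x) = x"
  and homeo_group_f_inv [simp]: "f \<in> G \<Longrightarrow> f (inv f x) = x"
  using homeo_group_homeomorphism[of f] by (auto simp: homeomorphism_def)

lemma homeo_group_measure:
  assumes "f \<in> G" "clopen U" shows "measure \<mu> (f -` U) = measure \<mu> U"
proof -
  have "f \<in> measurable \<mu> \<mu>"
    using borel_measurable_continuous_onI[OF homeo_group_continuous[OF assms(1)]]
    by (simp add: sets_eq cong: measurable_cong_sets)
  then have "measure (distr \<mu> \<mu> f) U = measure \<mu> (f -` U)"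
    using assms by (simp add: measure_distr clopen_in_sets space_eq)
  then show ?thesis using assms(1) by (simp add: homeo_group_def)
qed

lemma homeo_group_clopen: "f \<in> G \<Longrightarrow> clopen U \<Longrightarrow> clopen (f -` U)"
  using homeo_group_continuous[of f] by (auto simp: clopen_def intro: open_vimage closed_vimage)

lemma homeo_group_vimage_inv: "f \<in> G \<Longrightarrow> inv f -` U = f ` U"
  by (auto intro: image_eqI[where f = f, OF homeo_group_f_inv[symmetric]])

lemma homeo_group_inv: "f \<in> G \<Longrightarrow> inv f \<in> G"
proof (rule homeo_groupI[of "inv f" f])
  assume f: "f \<in> G"
  then show "continuous_on UNIV (inv f)" "continuous_on UNIV f"
    using homeo_group_homeomorphism[of f] by (auto simp: homeomorphism_def)
  fix U :: "cantor set" assume U: "clopen U"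
  have "inv f -` U = f ` U" by (rule homeo_group_vimage_inv[OF f])
  moreover have "f -` (f ` U) = U" using f by (auto dest: arg_cong[where f = "inv f"])
  moreover have "clopen (inv f -` U)"
    using U f homeo_group_homeomorphism[of f]
    by (auto simp: clopen_def homeomorphism_def intro: open_vimage closed_vimage)
  ultimately show "measure \<mu> (inv f -` U) = measure \<mu> U"
    using homeo_group_measure[OF f, of "f ` U"] by simp
qed auto

lemma homeo_group_clopen_image: "f \<in> G \<Longrightarrow> clopen U \<Longrightarrow> clopen (f ` U)"
  and homeo_group_measure_image: "f \<in> G \<Longrightarrow> clopen U \<Longrightarrow> measure \<mu> (f ` U) = measure \<mu> U"
  using homeo_group_inv[of f] homeo_group_clopen[of "inv f" U] homeo_group_measure[of "inv f" U]
  by (auto simp: homeo_group_vimage_inv)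

lemma homeo_group_comp:
  assumes "f \<in> G" "g \<in> G" shows "f \<circ> g \<in> G"
proof (rule homeo_groupI[of _ "inv g \<circ> inv f"])
  show "continuous_on UNIV (f \<circ> g)" "continuous_on UNIV (inv g \<circ> inv f)"
    using assms homeo_group_inv
    by (meson continuous_on_compose continuous_on_subset homeo_group_continuous subset_UNIV)+
  show "measure \<mu> ((f \<circ> g) -` U) = measure \<mu> U" if "clopen U" for U
    using that assms by (simp add: vimage_comp[symmetric] homeo_group_measure homeo_group_clopen)
qed (use assms in auto)

lemma homeo_group_inv_inv [simp]: "f \<in> G \<Longrightarrow> inv (inv f) = f"
  using homeo_group_homeomorphism[of f] by (intro inv_equality) auto

section \<open>Partial isomorphisms\<close>

text \<open>Unique membership, in place of \<open>partition_on\<close>, tolerates the pair of two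
  empty sets, which arises when a piece is cut by a set that misses it.\<close>

definition partial_iso :: "(cantor set \<times> cantor set) set \<Rightarrow> bool" where
  "partial_iso S \<longleftrightarrow> finite S \<and>
     (\<forall>s\<in>S. clopen (fst s) \<and> clopen (snd s) \<and> measure \<mu> (fst s) = measure \<mu> (snd s)) \<and>
     (\<forall>x. \<exists>!s. s \<in> S \<and> x \<in> fst s) \<and> (\<forall>y. \<exists>!s. s \<in> S \<and> y \<in> snd s)"

lemma partial_isoD:
  assumes "partial_iso S"
  shows "finite S" "\<And>s. s \<in> S \<Longrightarrow> clopen (fst s)" "\<And>s. s \<in> S \<Longrightarrow> clopen (snd s)"
    "\<And>s. s \<in> S \<Longrightarrow> measure \<mu> (fst s) = measure \<mu> (snd s)"
    "\<And>x. \<exists>!s. s \<in> S \<and> x \<in> fst s" "\<And>y. \<exists>!s. s \<in> S \<and> y \<in> snd s"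
  using assms by (auto simp: partial_iso_def)

lemma partial_iso_eq:
  assumes "partial_iso S" "s \<in> S" "t \<in> S"
  shows "x \<in> fst s \<Longrightarrow> x \<in> fst t \<Longrightarrow> s = t" "x \<in> snd s \<Longrightarrow> x \<in> snd t \<Longrightarrow> s = t"
  using partial_isoD(5,6)[OF assms(1), of x] assms(2,3) by blast+

lemma partial_iso_family:
  assumes "finite I" "\<And>i. i \<in> I \<Longrightarrow> clopen (p i)" "\<And>i. i \<in> I \<Longrightarrow> clopen (q i)"
    "\<And>i. i \<in> I \<Longrightarrow> measure \<mu> (p i) = measure \<mu> (q i)"
    and p: "\<And>x. \<exists>!i. i \<in> I \<and> x \<in> p i" and q: "\<And>x. \<exists>!i. i \<in> I \<and> x \<in> q i"
  shows "partial_iso ((\<lambda>i. (p i, q i)) ` I)"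
proof -
  have "\<exists>!s. s \<in> (\<lambda>i. (p i, q i)) ` I \<and> x \<in> fst s" for x
  proof -
    obtain i where i: "i \<in> I" "x \<in> p i" using p by blast
    show ?thesis
    proof (rule ex1I[of _ "(p i, q i)"])
      fix s assume "s \<in> (\<lambda>i. (p i, q i)) ` I \<and> x \<in> fst s"
      then obtain j where "j \<in> I" "x \<in> p j" "s = (p j, q j)" by auto
      then show "s = (p i, q i)" using i p[of x] by blast
    qed (use i in auto)
  qed
  moreover have "\<exists>!s. s \<in> (\<lambda>i. (p i, q i)) ` I \<and> x \<in> snd s" for x
  proof -
    obtain i where i: "i \<in> I" "x \<in> q i" using q by blast
    show ?thesis
    proof (rule ex1I[of _ "(p i, q i)"])
      fix s assume "s \<in> (\<lambda>i. (p i, q i)) ` I \<and> x \<in> snd s"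
      then obtain j where "j \<in> I" "x \<in> q j" "s = (p j, q j)" by auto
      then show "s = (p i, q i)" using i q[of x] by blast
    qed (use i in auto)
  qed
  ultimately show ?thesis using assms(1-4) by (auto simp: partial_iso_def)
qed

lemma partial_iso_swap:
  assumes "partial_iso S" shows "partial_iso (prod.swap ` S)"
proof -
  have "partial_iso ((\<lambda>s. (snd s, fst s)) ` S)"
    using partial_isoD[OF assms] by (intro partial_iso_family) auto
  then show ?thesis by (simp add: prod.swap_def)
qed

lemma refines_swap: "refines S' S \<Longrightarrow> refines (prod.swap ` S') (prod.swap ` S)"
  by (fastforce simp: refines_def)

lemma mesh_swap: "mesh n S \<Longrightarrow> mesh n (prod.swap ` S)"
  by (auto simp: mesh_def)

lemma partial_iso_snd_ne: "partial_iso S \<Longrightarrow> s \<in> S \<Longrightarrow> fst s \<noteq> {} \<Longrightarrow> snd s \<noteq> {}"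
  using partial_isoD(2,4) measure_eq_0 by (metis measure_empty)

text \<open>At mesh \<open>n\<close> the set \<open>U\<close> is a union of second components, and
  its preimage is the union of their partners, which have the same measures.\<close>

lemma measure_vimage_realizes:
  assumes "partial_iso S" "mesh n S" "realizes h S" "\<And>x y. agree n x y \<Longrightarrow> x \<in> U \<longleftrightarrow> y \<in> U"
  shows "measure \<mu> (h -` U) = measure \<mu> U"
proof -
  note S = partial_isoD[OF assms(1)]
  let ?T = "{s \<in> S. snd s \<inter> U \<noteq> {}}"
  have sub: "snd s \<subseteq> U" if "s \<in> ?T" for s
    using that assms(2,4) unfolding mesh_def by blast
  have U: "U = (\<Union>s\<in>?T. snd s)"
  proof (intro equalityI subsetI)
    fix y assume y: "y \<in> U"
    obtain s where "s \<in> S" "y \<in> snd s" using S(6)[of y] by blast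
    then show "y \<in> (\<Union>s\<in>?T. snd s)" using y by blast
  qed (use sub in blast)
  have hU: "h -` U = (\<Union>s\<in>?T. fst s)"
  proof (intro equalityI subsetI)
    fix x assume x: "x \<in> h -` U"
    obtain s where "s \<in> S" "x \<in> fst s" using S(5)[of x] by blast
    then show "x \<in> (\<Union>s\<in>?T. fst s)" using x assms(3) unfolding realizes_def by blast
  next
    fix x assume "x \<in> (\<Union>s\<in>?T. fst s)"
    then show "x \<in> h -` U" using sub assms(3) unfolding realizes_def by blast
  qed
  have "disjoint_family_on snd ?T" "disjoint_family_on fst ?T"
    using partial_iso_eq[OF assms(1)] unfolding disjoint_family_on_def by blast+
  then show ?thesis
    using measure_UN_clopen[of ?T fst] measure_UN_clopen[of ?T snd] S U hU by simp
qed

lemma partial_iso_limit_map: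
  assumes S: "\<And>n. partial_iso (S n)" "\<And>n. mesh n (S n)" "\<And>n. refines (S (Suc n)) (S n)"
  shows "\<exists>h. \<forall>n. realizes h (S n)"
proof (rule limit_map)
  fix n x s
  show "\<exists>!s. s \<in> S n \<and> x \<in> fst s" by (rule partial_isoD(5)[OF S(1)])
  show "clopen (snd s)" if "s \<in> S n" by (rule partial_isoD(3)[OF S(1) that])
  show "snd s \<noteq> {}" if "s \<in> S n" "fst s \<noteq> {}" by (rule partial_iso_snd_ne[OF S(1) that])
qed (rule S)+

text \<open>The swapped sequence satisfies the same hypotheses, and its limit \<open>g\<close> is
  the inverse of \<open>h\<close>: at every stage \<open>g (h x)\<close> and \<open>x\<close> lie in
  one piece, and the pieces shrink.\<close>

lemma partial_iso_limit:
  assumes S: "\<And>n. partial_iso (S n)" "\<And>n. mesh n (S n)" "\<And>n. refines (S (Suc n)) (S n)"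
  obtains h where "h \<in> G" "\<And>n. realizes h (S n)"
proof -
  obtain h where h: "\<And>n. realizes h (S n)"
    using partial_iso_limit_map[OF S] by blast
  let ?T = "\<lambda>n. prod.swap ` S n"
  have T: "\<And>n. partial_iso (?T n)" "\<And>n. mesh n (?T n)" "\<And>n. refines (?T (Suc n)) (?T n)"
    using S partial_iso_swap mesh_swap refines_swap by blast+
  obtain g where g: "\<And>n. realizes g (?T n)"
    using partial_iso_limit_map[OF T] by blast
  have mem: "\<exists>s\<in>S n. x \<in> fst s \<and> h x \<in> snd s" for n x
  proof -
    obtain s where "s \<in> S n" "x \<in> fst s" using partial_isoD(5)[OF S(1)[of n], of x] by blast
    then show ?thesis using h[of n] unfolding realizes_def by blast
  qed
  have memg: "\<exists>s\<in>S n. g y \<in> fst s \<and> y \<in> snd s" for n y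
  proof -
    obtain s where s: "s \<in> S n" "y \<in> snd s" using partial_isoD(6)[OF S(1)[of n], of y] by blast
    then have "prod.swap s \<in> ?T n" by blast
    then have "g ` fst (prod.swap s) \<subseteq> snd (prod.swap s)" using g[of n] unfolding realizes_def by blast
    then show ?thesis using s by auto
  qed
  have agS: "agree n x y" if "s \<in> S n" "x \<in> fst s \<and> y \<in> fst s \<or> x \<in> snd s \<and> y \<in> snd s" for n x y s
    using S(2) that unfolding mesh_def by blast
  have gh: "g (h x) = x" for x
  proof (rule agree_imp_eq)
    fix n
    obtain s where s: "s \<in> S n" "x \<in> fst s" "h x \<in> snd s" using mem by blast
    obtain t where t: "t \<in> S n" "g (h x) \<in> fst t" "h x \<in> snd t" using memg by blast
    have "s = t" by (rule partial_iso_eq(2)[OF S(1) s(1) t(1) s(3) t(3)])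
    then show "agree n (g (h x)) x" using agS[OF s(1)] s t by blast
  qed
  have hg: "h (g y) = y" for y
  proof (rule agree_imp_eq)
    fix n
    obtain s where s: "s \<in> S n" "g y \<in> fst s" "h (g y) \<in> snd s" using mem by blast
    obtain t where t: "t \<in> S n" "g y \<in> fst t" "y \<in> snd t" using memg by blast
    have "s = t" by (rule partial_iso_eq(1)[OF S(1) s(1) t(1) s(2) t(2)])
    then show "agree n (h (g y)) y" using agS[OF s(1)] s t by blast
  qed
  \<comment> \<open>Stated for an arbitrary sequence so that it serves both \<open>h\<close> and
    \<open>g\<close>. Nearby points share a first component because these are clopen, and the mesh
    bounds the second component that holds their images.\<close>
  have cont: "continuous_on UNIV k"
    if T: "\<And>n. partial_iso (T n)" "\<And>n. mesh n (T n)" "\<And>n. realizes k (T n)" for k T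
  proof (rule continuousI_agree)
    fix n
    note D = partial_isoD[OF T(1)[of n]]
    obtain m where m: "\<And>U x y. U \<in> fst ` T n \<Longrightarrow> agree m x y \<Longrightarrow> x \<in> U \<longleftrightarrow> y \<in> U"
    proof (rule finite_clopenE_agree)
      show "finite (fst ` T n)" using D(1) by simp
      show "clopen U" if "U \<in> fst ` T n" for U using that D(2) by blast
    qed (rule that)
    have "agree n (k x) (k y)" if "agree m x y" for x y
    proof -
      obtain s where s: "s \<in> T n" "x \<in> fst s" using D(5) by blast
      then have "y \<in> fst s" using m[of "fst s"] that by blast
      then have "k x \<in> snd s" "k y \<in> snd s" using s T(3) unfolding realizes_def by blast+
      then show ?thesis using T(2)[of n] s unfolding mesh_def by blast
    qed
    then show "\<exists>m. \<forall>x y. agree m x y \<longrightarrow> agree n (k x) (k y)" by blast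
  qed
  have "h \<in> G"
  proof (rule homeo_groupI[OF cont[of S h] cont[of ?T g] gh hg])
    fix U :: "cantor set" assume "clopen U"
    then obtain n where n: "\<And>x y. agree n x y \<Longrightarrow> x \<in> U \<longleftrightarrow> y \<in> U" using clopenE_agree by blast
    show "measure \<mu> (h -` U) = measure \<mu> U"
      by (rule measure_vimage_realizes[OF S(1,2) h n])
  qed (use S T h g in auto)
  then show ?thesis using that h by blast
qed

section \<open>Back and forth\<close>

text \<open>The forth step. Goodness finds in each second component a clopen \<open>W s\<close> as
  large as the part of the first component inside \<open>C\<close>; the two remainders then have
  equal measure as well.\<close>

lemma partial_iso_split:
  assumes S: "partial_iso S" and C: "clopen C"
  obtains S' where "partial_iso S'" "refines S' S" "\<And>s. s \<in> S' \<Longrightarrow> fst s \<subseteq> C \<or> fst s \<subseteq> - C"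
proof -
  note D = partial_isoD[OF S]
  have "\<exists>W. clopen W \<and> W \<subseteq> snd s \<and> measure \<mu> W = measure \<mu> (fst s \<inter> C)" if "s \<in> S" for s
  proof -
    have "measure \<mu> (fst s \<inter> C) \<le> measure \<mu> (snd s)"
      unfolding D(4)[OF that, symmetric]
      by (rule finite_measure_mono) (auto simp: D that clopen_in_sets)
    then show ?thesis
      using subset_of_measure[of "fst s \<inter> C" "snd s"] D that C clopen_Int by metis
  qed
  then obtain W where W: "\<And>s. s \<in> S \<Longrightarrow> clopen (W s)" "\<And>s. s \<in> S \<Longrightarrow> W s \<subseteq> snd s"
      "\<And>s. s \<in> S \<Longrightarrow> measure \<mu> (W s) = measure \<mu> (fst s \<inter> C)"
    by metis
  let ?p = "\<lambda>(s, b). if b then fst s \<inter> C else fst s - C"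
  let ?q = "\<lambda>(s, b). if b then W s else snd s - W s"
  let ?S = "(\<lambda>i. (?p i, ?q i)) ` (S \<times> (UNIV :: bool set))"
  have "measure \<mu> (fst s - C) = measure \<mu> (snd s - W s)" if "s \<in> S" for s
  proof -
    have "fst s - C = fst s - (fst s \<inter> C)" by blast
    then show ?thesis
      using measure_Diff_clopen[of "fst s \<inter> C" "fst s"] measure_Diff_clopen[of "W s" "snd s"]
        D W clopen_Int[OF D(2)[OF that] C] that by simp
  qed
  moreover have "\<exists>!i. i \<in> S \<times> UNIV \<and> x \<in> ?p i" for x
  proof -
    obtain s where s: "s \<in> S" "x \<in> fst s" using D(5) by blast
    show ?thesis
    proof (rule ex1I[of _ "(s, x \<in> C)"])
      fix i assume i: "i \<in> S \<times> UNIV \<and> x \<in> ?p i"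
      then have "x \<in> fst (fst i)" "fst i \<in> S" by (auto split: if_splits)
      then have "fst i = s" using D(5)[of x] s by blast
      then show "i = (s, x \<in> C)" using i by (cases i) (auto split: if_splits)
    qed (use s in auto)
  qed
  moreover have "\<exists>!i. i \<in> S \<times> UNIV \<and> x \<in> ?q i" for x
  proof -
    obtain s where s: "s \<in> S" "x \<in> snd s" using D(6) by blast
    show ?thesis
    proof (rule ex1I[of _ "(s, x \<in> W s)"])
      fix i assume i: "i \<in> S \<times> UNIV \<and> x \<in> ?q i"
      then have "x \<in> snd (fst i)" "fst i \<in> S" using W(2)[of "fst i"] by (auto split: if_splits)
      then have "fst i = s" using D(6)[of x] s by blast
      then show "i = (s, x \<in> W s)" using i by (cases i) (auto split: if_splits)
    qed (use s in auto)
  qed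
  ultimately have "partial_iso ?S"
    using D W C by (intro partial_iso_family) (auto simp: clopen_Int clopen_Diff)
  moreover have "refines ?S S"
    unfolding refines_def
  proof (intro ballI)
    fix s' assume "s' \<in> ?S"
    then obtain s b where "s \<in> S" "s' = (?p (s, b), ?q (s, b))" by blast
    then show "\<exists>s\<in>S. fst s' \<subseteq> fst s \<and> snd s' \<subseteq> snd s"
      using W(2)[of s] by (intro bexI[of _ s]) auto
  qed
  moreover have "fst s \<subseteq> C \<or> fst s \<subseteq> - C" if "s \<in> ?S" for s
    using that by (auto split: if_splits)
  ultimately show ?thesis using that by blast
qed

text \<open>Split the first components, swap the sides, split again and swap back. The second
  refinement keeps the first split intact.\<close>

lemma partial_iso_split_both:
  assumes S: "partial_iso S" and C: "clopen C"
  obtains S' where "partial_iso S'" "refines S' S"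
    "\<And>s. s \<in> S' \<Longrightarrow> fst s \<subseteq> C \<or> fst s \<subseteq> - C" "\<And>s. s \<in> S' \<Longrightarrow> snd s \<subseteq> C \<or> snd s \<subseteq> - C"
proof -
  obtain S1 where S1: "partial_iso S1" "refines S1 S" "\<And>s. s \<in> S1 \<Longrightarrow> fst s \<subseteq> C \<or> fst s \<subseteq> - C"
    using partial_iso_split[OF assms] by blast
  obtain S2 where S2: "partial_iso S2" "refines S2 (prod.swap ` S1)" "\<And>s. s \<in> S2 \<Longrightarrow> fst s \<subseteq> C \<or> fst s \<subseteq> - C"
    using partial_iso_split[OF partial_iso_swap[OF S1(1)] C] by blast
  have ref: "refines (prod.swap ` S2) S1"
    using refines_swap[OF S2(2)] by (simp add: image_comp comp_def)
  show ?thesis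
  proof (rule that[of "prod.swap ` S2"])
    show "partial_iso (prod.swap ` S2)" by (rule partial_iso_swap[OF S2(1)])
    show "refines (prod.swap ` S2) S" using ref S1(2) refines_trans by blast
    show "fst s \<subseteq> C \<or> fst s \<subseteq> - C" if "s \<in> prod.swap ` S2" for s
      using ref S1(3) that unfolding refines_def by (meson subset_trans)
    show "snd s \<subseteq> C \<or> snd s \<subseteq> - C" if "s \<in> prod.swap ` S2" for s
      using S2(3) that by (metis imageE snd_swap)
  qed
qed

text \<open>Starting from \<open>S\<close>, stage \<open>n\<close> cuts both sides along coordinate
  \<open>n\<close>, which raises the mesh bound by one; the limit of the stages is the required
  homeomorphism.\<close>

lemma partial_iso_extend:
  assumes "partial_iso S"
  obtains h where "h \<in> G" "realizes h S"
proof -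
  have "\<exists>T. \<forall>n. (partial_iso (T n) \<and> mesh n (T n) \<and> (n = 0 \<longrightarrow> T n = S)) \<and> refines (T (Suc n)) (T n)"
  proof (rule dependent_nat_choice)
    show "\<exists>T. partial_iso T \<and> mesh 0 T \<and> (0 = (0 :: nat) \<longrightarrow> T = S)"
      using assms by (auto simp: mesh_def)
  next
    fix T n assume T: "partial_iso T \<and> mesh n T \<and> (n = 0 \<longrightarrow> T = S)"
    then obtain T' where T': "partial_iso T'" "refines T' T"
      "\<And>s. s \<in> T' \<Longrightarrow> fst s \<subseteq> {x. x n} \<or> fst s \<subseteq> - {x. x n}"
      "\<And>s. s \<in> T' \<Longrightarrow> snd s \<subseteq> {x. x n} \<or> snd s \<subseteq> - {x. x n}"
      using partial_iso_split_both[OF _ clopen_coordinate, of T n] by metis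
    have "mesh (Suc n) T'"
      unfolding mesh_def
    proof (intro ballI conjI)
      fix s x y assume s: "s \<in> T'"
      obtain t where t: "t \<in> T" "fst s \<subseteq> fst t" "snd s \<subseteq> snd t"
        using T'(2) s unfolding refines_def by blast
      {
        assume xy: "x \<in> fst s" "y \<in> fst s"
        then have "agree n x y" using t T unfolding mesh_def by blast
        moreover have "x n = y n" using T'(3)[OF s] xy by blast
        ultimately show "agree (Suc n) x y" by (simp add: agree_Suc)
      }
      {
        assume xy: "x \<in> snd s" "y \<in> snd s"
        then have "agree n x y" using t T unfolding mesh_def by blast
        moreover have "x n = y n" using T'(4)[OF s] xy by blast
        ultimately show "agree (Suc n) x y" by (simp add: agree_Suc)
      }
    qed
    then show "\<exists>T'. (partial_iso T' \<and> mesh (Suc n) T' \<and> (Suc n = 0 \<longrightarrow> T' = S)) \<and> refines T' T"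
      using T' by blast
  qed
  then obtain T where T: "\<And>n. partial_iso (T n)" "\<And>n. mesh n (T n)" "T 0 = S" "\<And>n. refines (T (Suc n)) (T n)"
    by blast
  obtain h where "h \<in> G" "\<And>n. realizes h (T n)"
    by (rule partial_iso_limit[of T, OF T(1,2,4)]) (rule that)
  then show ?thesis using that T(3) by metis
qed

section \<open>The topology of the homeomorphism group\<close>

abbreviation "T \<equiv> compact_open_topology G"

text \<open>Basic neighbourhoods for uniform convergence, which by \<open>openin_iff\<close>
  generate the compact-open topology on \<open>G\<close>.\<close>

definition unif_ball :: "(cantor \<Rightarrow> cantor) \<Rightarrow> nat \<Rightarrow> (cantor \<Rightarrow> cantor) set" where
  "unif_ball f n = {g \<in> G. \<forall>x. agree n (g x) (f x)}"

lemma unif_ball_refl: "f \<in> G \<Longrightarrow> f \<in> unif_ball f n"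
  by (simp add: unif_ball_def)

lemma unif_ball_mono: "m \<le> n \<Longrightarrow> unif_ball f n \<subseteq> unif_ball f m"
  by (auto simp: unif_ball_def agree_def)

lemma openin_subbasic:
  assumes "compact K" "open U" shows "openin T {f \<in> G. f ` K \<subseteq> U}"
proof -
  have "generate_topology_on {{f :: cantor \<Rightarrow> cantor. f ` K \<subseteq> U} | K U. compact K \<and> open U} {f. f ` K \<subseteq> U}"
    using assms by (intro generate_topology_on.Basis) blast
  then show ?thesis
    unfolding compact_open_topology_def openin_subtopology openin_topology_generated_by_iff
    by (intro exI[of _ "{f. f ` K \<subseteq> U}"]) blast
qed

lemma openin_unif_ball:
  assumes f: "f \<in> G" shows "openin T (unif_ball f n)"
proof (induction n)
  case 0
  have "unif_ball f 0 = topspace T" by (simp add: unif_ball_def topspace_compact_open_topology)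
  then show ?case by (metis openin_topspace)
next
  case (Suc n)
  have sub: "openin T {g \<in> G. g ` (f -` C) \<subseteq> C}" if "clopen C" for C
  proof (rule openin_subbasic)
    show "open C" using that by (simp add: clopen_def)
    have "closed (f -` C)" using homeo_group_clopen[OF f that] by (simp add: clopen_def)
    then show "compact (f -` C)" using compact_Int_closed[OF compact_UNIV_cantor] by simp
  qed
  let ?C = "{x :: cantor. x n}"
  \<comment> \<open>One more coordinate costs two subbasic conditions: \<open>g\<close> must keep
    the compact sets on which \<open>f\<close> has coordinate \<open>n\<close> true, respectively
    false, on their sides.\<close>
  have "unif_ball f (Suc n) = unif_ball f n \<inter> ({g \<in> G. g ` (f -` ?C) \<subseteq> ?C} \<inter> {g \<in> G. g ` (f -` (- ?C)) \<subseteq> - ?C})"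
    by (auto simp: unif_ball_def agree_Suc image_subset_iff)
  moreover have "clopen (- ?C)"
    using clopen_Diff[OF clopen_UNIV clopen_coordinate] by (simp add: Compl_eq_Diff_UNIV)
  ultimately show ?case
    using Suc sub[OF clopen_coordinate[of n]] sub[of "- ?C"] by (simp only: openin_Int)
qed

text \<open>For a subbasic set, the image of \<open>K\<close> under \<open>f\<close> is a compact
  part of \<open>U\<close>, so by \<open>compact_open_agree\<close> all maps in some ball around
  \<open>f\<close> still send \<open>K\<close> into \<open>U\<close>. Finite intersections take the
  larger level.\<close>

lemma openin_iff:
  "openin T W \<longleftrightarrow> W \<subseteq> G \<and> (\<forall>f\<in>W. \<exists>n. unif_ball f n \<subseteq> W)"
proof
  assume "openin T W"
  then obtain W' where W': "generate_topology_on {{f :: cantor \<Rightarrow> cantor. f ` K \<subseteq> U} | K U. compact K \<and> open U} W'"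
      "W = W' \<inter> G"
    unfolding compact_open_topology_def openin_subtopology openin_topology_generated_by_iff by blast
  have "\<forall>f\<in>W'. f \<in> G \<longrightarrow> (\<exists>n. unif_ball f n \<subseteq> W')"
    using W'(1)
  proof (induction rule: generate_topology_on.induct)
    case (Int A B)
    show ?case
    proof (intro ballI impI)
      fix f assume "f \<in> A \<inter> B" "f \<in> G"
      then obtain m n where "unif_ball f m \<subseteq> A" "unif_ball f n \<subseteq> B" using Int.IH by blast
      then show "\<exists>n. unif_ball f n \<subseteq> A \<inter> B"
        using unif_ball_mono[of m "max m n" f] unif_ball_mono[of n "max m n" f]
        by (intro exI[of _ "max m n"]) auto
    qed
  next
    case (Basis A)
    then obtain K U where A: "A = {f. f ` K \<subseteq> U}" "compact K" "open U" by blast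
    show ?case
    proof (intro ballI impI)
      fix f assume f: "f \<in> A" "f \<in> G"
      have "compact (f ` K)"
        using A(2) homeo_group_continuous[OF f(2)] compact_continuous_image continuous_on_subset by blast
      then obtain n where n: "\<And>x y. x \<in> f ` K \<Longrightarrow> agree n x y \<Longrightarrow> y \<in> U"
        using compact_open_agree[OF _ A(3)] f(1) A(1) by blast
      have "g x \<in> U" if "g \<in> unif_ball f n" "x \<in> K" for g x
        using n[of "f x" "g x"] that agree_sym by (auto simp: unif_ball_def)
      then show "\<exists>n. unif_ball f n \<subseteq> A" unfolding A(1) by blast
    qed
  qed blast+
  then show "W \<subseteq> G \<and> (\<forall>f\<in>W. \<exists>n. unif_ball f n \<subseteq> W)"
    using W'(2) unfolding unif_ball_def by blast
next
  assume W: "W \<subseteq> G \<and> (\<forall>f\<in>W. \<exists>n. unif_ball f n \<subseteq> W)"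
  show "openin T W"
  proof (subst openin_subopen, intro ballI)
    fix f assume f: "f \<in> W"
    then obtain n where "unif_ball f n \<subseteq> W" using W by blast
    then show "\<exists>A. openin T A \<and> f \<in> A \<and> A \<subseteq> W"
      using openin_unif_ball[of f n] unif_ball_refl[of f n] f W by (intro exI[of _ "unif_ball f n"]) blast
  qed
qed

text \<open>A ball depends only on the \<open>n\<close> clopen sets on which the coordinates of
  \<open>f\<close> below \<open>n\<close> are true, and there are countably many clopen
  sets.\<close>

lemma countable_unif_balls: "countable {unif_ball f n | f n. f \<in> G}"
proof (rule countable_subset)
  let ?F = "\<lambda>l. {g \<in> G. \<forall>k<length l. {x. g x k} = l ! k}"
  show "countable (?F ` lists {U :: cantor set. clopen U})"
    by (intro countable_image countable_lists countable_clopen)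
  have eq: "unif_ball f n = ?F (map (\<lambda>k. {x. f x k}) [0..<n])" for f n
    by (auto simp: unif_ball_def agree_def)
  have "clopen {x. f x k}" if "f \<in> G" for f k
    using homeo_group_clopen[OF that clopen_coordinate[of k]] by (simp add: vimage_def)
  then have "map (\<lambda>k. {x. f x k}) [0..<n] \<in> lists {U. clopen U}" if "f \<in> G" for f n
    using that by (auto simp: lists_eq_set)
  then have "unif_ball f n \<in> ?F ` lists {U. clopen U}" if "f \<in> G" for f n
    using that by (intro image_eqI[where x = "map (\<lambda>k. {x. f x k}) [0..<n]"] eq)
  then show "{unif_ball f n | f n. f \<in> G} \<subseteq> ?F ` lists {U. clopen U}"
    by (intro subsetI, elim CollectE exE conjE) (simp only:)
qed

lemma openin_realizes:
  assumes "partial_iso S" shows "openin T {h \<in> G. realizes h S}"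
proof -
  note D = partial_isoD[OF assms]
  obtain n where n: "\<And>U x y. U \<in> snd ` S \<Longrightarrow> agree n x y \<Longrightarrow> x \<in> U \<longleftrightarrow> y \<in> U"
  proof (rule finite_clopenE_agree)
    show "finite (snd ` S)" using D(1) by simp
    show "clopen U" if "U \<in> snd ` S" for U using that D(3) by blast
  qed (rule that)
  have "realizes g S" if "realizes f S" "g \<in> unif_ball f n" for f g
    unfolding realizes_def
  proof (intro ballI image_subsetI)
    fix s x assume s: "s \<in> S" "x \<in> fst s"
    then have "f x \<in> snd s" using that(1) unfolding realizes_def by blast
    then show "g x \<in> snd s"
      using n[of "snd s" "g x" "f x"] s(1) that(2) by (simp add: unif_ball_def)
  qed
  then show ?thesis
    unfolding openin_iff unif_ball_def by blast
qed

text \<open>Pair each sufficiently long cylinder with its image under \<open>f\<close>. A map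
  realizing these pairs differs from \<open>f\<close> by at most the oscillation of \<open>f\<close>
  on one cylinder.\<close>

lemma partial_iso_approx:
  assumes S: "partial_iso S" and f: "f \<in> W" "realizes f S" and W: "openin T W"
  obtains S' where "partial_iso S'" "refines S' S" "mesh n S'" "realizes f S'"
    "{h \<in> G. realizes h S'} \<subseteq> W"
proof -
  note D = partial_isoD[OF S]
  have fG: "f \<in> G" using W f(1) by (auto simp: openin_iff)
  obtain m where m: "unif_ball f m \<subseteq> W" using W f(1) by (auto simp: openin_iff)
  obtain k where k: "\<And>x y. agree k x y \<Longrightarrow> agree (max m n) (f x) (f y)"
    using continuous_agree[OF homeo_group_continuous[OF fG]] by blast
  obtain j where j: "\<And>U x y. U \<in> fst ` S \<Longrightarrow> agree j x y \<Longrightarrow> x \<in> U \<longleftrightarrow> y \<in> U"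
  proof (rule finite_clopenE_agree)
    show "finite (fst ` S)" using D(1) by simp
    show "clopen U" if "U \<in> fst ` S" for U using that D(2) by blast
  qed (rule that)
  \<comment> \<open>Here \<open>k\<close> bounds the oscillation of \<open>f\<close>,
    \<open>j\<close> makes every cylinder fit into one first component of \<open>S\<close>, and
    \<open>n\<close> gives the mesh on the first side.\<close>
  let ?r = "max (max k j) n"
  let ?S = "(\<lambda>c. (c, f ` c)) ` cells ?r"
  have r: "agree k x y" "agree j x y" "agree n x y" if "agree ?r x y" for x y
    using that agree_mono[of ?r x y] by auto
  have iso: "partial_iso ?S"
  proof (rule partial_iso_family)
    show "\<exists>!c. c \<in> cells ?r \<and> x \<in> c" for x
      by (rule clopen_partition_ex1[OF clopen_partition_cells])
    show "\<exists>!c. c \<in> cells ?r \<and> x \<in> f ` c" for x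
    proof -
      have "x \<in> f ` c \<longleftrightarrow> inv f x \<in> c" for c
        using homeo_group_vimage_inv[OF fG, of c] by auto
      then show ?thesis using clopen_partition_ex1[OF clopen_partition_cells, of ?r "inv f x"] by simp
    qed
  qed (auto simp: finite_cells clopen_cells fG homeo_group_clopen_image homeo_group_measure_image)
  have cell: "agree ?r x y" if "c \<in> cells ?r" "x \<in> c" "y \<in> c" for c x y
    using cells_agree that by blast
  have fcell: "agree (max m n) (f x) (f y)" if "c \<in> cells ?r" "x \<in> c" "y \<in> c" for c x y
    using cell[OF that] r(1) k by blast
  have ref: "refines ?S S"
    unfolding refines_def
  proof (intro ballI)
    fix s' assume "s' \<in> ?S"
    then obtain c where c: "c \<in> cells ?r" "s' = (c, f ` c)" by blast
    then obtain x where x: "x \<in> c" using clopen_partitionD(3)[OF clopen_partition_cells, of ?r] by (metis equals0I)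
    obtain s where s: "s \<in> S" "x \<in> fst s" using D(5)[of x] by blast
    have "c \<subseteq> fst s"
      using j[of "fst s" x] s cell[OF c(1) x] r(2) by blast
    moreover from this have "f ` c \<subseteq> snd s" using f(2) s(1) unfolding realizes_def by blast
    ultimately show "\<exists>s\<in>S. fst s' \<subseteq> fst s \<and> snd s' \<subseteq> snd s" using s(1) c(2) by auto
  qed
  have mesh: "mesh n ?S"
    unfolding mesh_def using cell r(3) fcell agree_mono[of "max m n" _ _ n] by fastforce
  have real: "realizes f ?S" by (auto simp: realizes_def)
  have "h \<in> W" if h: "h \<in> G" "realizes h ?S" for h
  proof -
    have "agree m (h x) (f x)" for x
    proof -
      have c: "cell ?r x \<in> cells ?r" "x \<in> cell ?r x" by (auto simp: cells_def)
      then have "h x \<in> f ` cell ?r x" using h(2) unfolding realizes_def by fastforce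
      then obtain y where "y \<in> cell ?r x" "h x = f y" by blast
      then show ?thesis using fcell[OF c(1), of y x] c(2) agree_mono[of "max m n" _ _ m] by simp
    qed
    then show ?thesis using m h(1) unfolding unif_ball_def by blast
  qed
  then show ?thesis using that[of ?S] iso ref mesh real by blast
qed

section \<open>Baire category\<close>

text \<open>Finite approximations replace a complete metric. The partial isomorphisms are refined so
  that every map realizing stage \<open>Suc n\<close> lies in \<open>D n\<close>; their limit exists
  in \<open>G\<close> and is the common point.\<close>

lemma baire_seq:
  fixes D :: "nat \<Rightarrow> (cantor \<Rightarrow> cantor) set"
  assumes D: "\<And>n. openin T (D n)" "\<And>n W. openin T W \<Longrightarrow> W \<noteq> {} \<Longrightarrow> W \<inter> D n \<noteq> {}"
    and Y: "openin T Y" "Y \<noteq> {}"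
  obtains h where "h \<in> Y" "\<And>n. h \<in> D n"
proof -
  let ?N = "\<lambda>S. {h \<in> G. realizes h S}"
  have triv: "partial_iso {(UNIV, UNIV)}" "realizes f {(UNIV, UNIV)}" for f
    by (auto simp: partial_iso_def realizes_def)
  \<comment> \<open>Nonemptiness of \<open>?N (S n)\<close> is carried along so that density of
    \<open>D n\<close> applies at the next stage; the clause for \<open>n = 0\<close> puts the
    construction inside \<open>Y\<close>.\<close>
  have "\<exists>S. \<forall>n. (partial_iso (S n) \<and> mesh n (S n) \<and> ?N (S n) \<noteq> {} \<and> (n = 0 \<longrightarrow> ?N (S n) \<subseteq> Y)) \<and>
    (refines (S (Suc n)) (S n) \<and> ?N (S (Suc n)) \<subseteq> D n)"
  proof (rule dependent_nat_choice)
    obtain f where f: "f \<in> Y" using Y(2) by blast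
    then have "f \<in> G" using Y(1) by (auto simp: openin_iff)
    moreover obtain S where "partial_iso S" "mesh 0 S" "realizes f S" "?N S \<subseteq> Y"
      by (rule partial_iso_approx[OF triv(1) f triv(2) Y(1), of 0]) (rule that)
    ultimately show "\<exists>S. partial_iso S \<and> mesh 0 S \<and> ?N S \<noteq> {} \<and> ((0 :: nat) = 0 \<longrightarrow> ?N S \<subseteq> Y)"
      by blast
  next
    fix S n assume S: "partial_iso S \<and> mesh n S \<and> ?N S \<noteq> {} \<and> (n = 0 \<longrightarrow> ?N S \<subseteq> Y)"
    then obtain f where f: "f \<in> ?N S \<inter> D n" using D(2)[OF openin_realizes[of S]] by blast
    then have f': "realizes f S" "f \<in> G" by auto
    obtain S' where "partial_iso S'" "refines S' S" "mesh (Suc n) S'" "realizes f S'" "?N S' \<subseteq> ?N S \<inter> D n"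
      by (rule partial_iso_approx[OF conjunct1[OF S] f f'(1), of "Suc n"])
        (use S D openin_realizes in auto)
    then show "\<exists>S'. (partial_iso S' \<and> mesh (Suc n) S' \<and> ?N S' \<noteq> {} \<and> (Suc n = 0 \<longrightarrow> ?N S' \<subseteq> Y)) \<and>
        (refines S' S \<and> ?N S' \<subseteq> D n)"
      using f'(2) by blast
  qed
  then obtain S where S: "\<And>n. partial_iso (S n)" "\<And>n. mesh n (S n)" "\<And>n. refines (S (Suc n)) (S n)"
      "?N (S 0) \<subseteq> Y" "\<And>n. ?N (S (Suc n)) \<subseteq> D n"
    by blast
  obtain h where h: "h \<in> G" "\<And>n. realizes h (S n)"
    by (rule partial_iso_limit[of S, OF S(1,2,3)]) (rule that)
  show ?thesis
  proof (rule that)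
    show "h \<in> Y" using h S(4) by blast
    show "h \<in> D n" for n using h S(5)[of n] by blast
  qed
qed

lemma baire:
  assumes "countable \<D>" "\<And>D. D \<in> \<D> \<Longrightarrow> openin T D"
    "\<And>D W. D \<in> \<D> \<Longrightarrow> openin T W \<Longrightarrow> W \<noteq> {} \<Longrightarrow> W \<inter> D \<noteq> {}"
    and Y: "openin T Y" "Y \<noteq> {}"
  obtains h where "h \<in> Y" "\<And>D. D \<in> \<D> \<Longrightarrow> h \<in> D"
proof (cases "\<D> = {}")
  case True
  then show ?thesis using Y that by blast
next
  case False
  then have r: "range (from_nat_into \<D>) = \<D>" by (rule range_from_nat_into[OF _ assms(1)])
  then have m: "from_nat_into \<D> n \<in> \<D>" for n by blast
  obtain h where h: "h \<in> Y" "\<And>n. h \<in> from_nat_into \<D> n"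
    by (rule baire_seq[of "from_nat_into \<D>", OF assms(2)[OF m] assms(3)[OF m] Y]) (auto intro: that)
  then show ?thesis using that r by (metis rangeE)
qed

section \<open>Conjugation\<close>

definition conjugate :: "(cantor \<Rightarrow> cantor) \<Rightarrow> (cantor \<Rightarrow> cantor) \<Rightarrow> cantor \<Rightarrow> cantor" where
  "conjugate h f = h \<circ> f \<circ> inv h"

lemma conjugate_in: "h \<in> G \<Longrightarrow> f \<in> G \<Longrightarrow> conjugate h f \<in> G"
  by (simp add: conjugate_def homeo_group_comp homeo_group_inv)

lemma conjugate_comp: "h \<in> G \<Longrightarrow> k \<in> G \<Longrightarrow> conjugate (h \<circ> k) f = conjugate h (conjugate k f)"
proof -
  assume "h \<in> G" "k \<in> G"
  then have "inv (h \<circ> k) = inv k \<circ> inv h"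
    by (intro inv_equality) (auto simp: homeo_group_inv)
  then show ?thesis by (simp add: conjugate_def comp_assoc)
qed

lemma conjugate_inv [simp]: "h \<in> G \<Longrightarrow> conjugate (inv h) (conjugate h f) = f" "h \<in> G \<Longrightarrow> conjugate h (conjugate (inv h) f) = f"
  by (auto simp: conjugate_def fun_eq_iff homeo_group_inv)

lemma unif_ball_conjugate:
  assumes h: "h \<in> G" and f: "f \<in> G"
  obtains m where "\<And>g. g \<in> unif_ball f m \<Longrightarrow> conjugate h g \<in> unif_ball (conjugate h f) n"
proof -
  obtain m where "\<And>x y. agree m x y \<Longrightarrow> agree n (h x) (h y)"
    using continuous_agree[OF homeo_group_continuous[OF h]] by blast
  then have "conjugate h g \<in> unif_ball (conjugate h f) n" if "g \<in> unif_ball f m" for g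
    using that h conjugate_in[of h g] by (auto simp: unif_ball_def conjugate_def)
  then show ?thesis using that by blast
qed

lemma openin_conjugate_vimage:
  assumes h: "h \<in> G" and W: "openin T W"
  shows "openin T {g \<in> G. conjugate h g \<in> W}"
  unfolding openin_iff
proof (intro conjI ballI)
  fix f assume "f \<in> {g \<in> G. conjugate h g \<in> W}"
  then have f: "f \<in> G" "conjugate h f \<in> W" by auto
  obtain n where n: "unif_ball (conjugate h f) n \<subseteq> W" using W f(2) by (auto simp: openin_iff)
  obtain m where "\<And>g. g \<in> unif_ball f m \<Longrightarrow> conjugate h g \<in> unif_ball (conjugate h f) n"
    by (rule unif_ball_conjugate[OF h f(1), of n]) (rule that)
  then have "unif_ball f m \<subseteq> {g \<in> G. conjugate h g \<in> W}"
    using n by (auto simp: unif_ball_def)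
  then show "\<exists>n. unif_ball f n \<subseteq> {g \<in> G. conjugate h g \<in> W}" ..
qed auto

lemma openin_conjugate_image:
  assumes h: "h \<in> G" and W: "openin T W"
  shows "openin T (conjugate h ` W)"
proof -
  have "W \<subseteq> G" using W by (simp add: openin_iff)
  then have "conjugate h ` W = {g \<in> G. conjugate (inv h) g \<in> W}"
    using h conjugate_in by (auto intro!: image_eqI[where f = "conjugate h", OF conjugate_inv(2)[symmetric]])
  then show ?thesis using openin_conjugate_vimage[OF homeo_group_inv[OF h] W] by simp
qed

lemma openin_orbit_vimage:
  assumes f: "f \<in> G" and W: "openin T W"
  shows "openin T {h \<in> G. conjugate h f \<in> W}"
  unfolding openin_iff
proof (intro conjI ballI)
  fix h assume "h \<in> {h \<in> G. conjugate h f \<in> W}"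
  then have h: "h \<in> G" "conjugate h f \<in> W" by auto
  obtain n where n: "unif_ball (conjugate h f) n \<subseteq> W" using W h(2) by (auto simp: openin_iff)
  obtain k where k: "\<And>x y. agree k x y \<Longrightarrow> agree n ((h \<circ> f) x) ((h \<circ> f) y)"
    using continuous_agree[OF homeo_group_continuous[OF homeo_group_comp[OF h(1) f]]] by blast
  obtain m where m: "\<And>x y. agree m x y \<Longrightarrow> agree k (inv h x) (inv h y)"
    using continuous_agree[OF homeo_group_continuous[OF homeo_group_inv[OF h(1)]]] by blast
  have "conjugate h' f \<in> unif_ball (conjugate h f) n" if h': "h' \<in> unif_ball h (max m n)" for h'
  proof -
    have h'G: "h' \<in> G" using h' by (simp add: unif_ball_def)
    have a: "agree m (h' x) (h x)" "agree n (h' x) (h x)" for x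
      using h' agree_mono[of "max m n"] by (auto simp: unif_ball_def)
    have "agree n (conjugate h' f y) (conjugate h f y)" for y
    proof -
      \<comment> \<open>Writing \<open>y\<close> as \<open>h' x\<close> removes the inverse of
        \<open>h'\<close>, so that only the fixed maps \<open>h \<circ> f\<close> and
        \<open>inv h\<close> need uniform continuity.\<close>
      define x where "x = inv h' y"
      have y: "y = h' x" using h'G by (simp add: x_def)
      have "agree n (h' (f x)) (h (f x))" by (rule a)
      moreover have "agree k (inv h (h x)) (inv h (h' x))" by (intro m agree_sym[OF a(1)])
      then have "agree n (h (f x)) (h (f (inv h (h' x))))"
        using k[of x "inv h (h' x)"] h(1) by simp
      ultimately have "agree n (h' (f x)) (h (f (inv h (h' x))))" by (rule agree_trans)
      then show ?thesis using h'G by (simp add: conjugate_def y)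
    qed
    then show ?thesis using conjugate_in[OF h'G f] by (simp add: unif_ball_def)
  qed
  then have "unif_ball h (max m n) \<subseteq> {h \<in> G. conjugate h f \<in> W}"
    using n by (auto simp: unif_ball_def)
  then show "\<exists>n. unif_ball h n \<subseteq> {h \<in> G. conjugate h f \<in> W}" ..
qed auto

section \<open>Generic elements\<close>

text \<open>Open subgroups that form a neighbourhood basis of the identity.\<close>

definition near_id :: "nat \<Rightarrow> (cantor \<Rightarrow> cantor) set" where
  "near_id n = {v \<in> G. \<forall>x. agree n (v x) x}"

text \<open>Local topological transitivity of the conjugation action of \<open>near_id n\<close>:
  any nonempty open part of \<open>W\<close> can be moved so as to meet any other.\<close>

definition homogeneous :: "nat \<Rightarrow> (cantor \<Rightarrow> cantor) set \<Rightarrow> bool" where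
  "homogeneous n W \<longleftrightarrow> openin T W \<and> W \<noteq> {} \<and> (\<forall>W0 W1. openin T W0 \<and> openin T W1 \<and>
     W0 \<noteq> {} \<and> W1 \<noteq> {} \<and> W0 \<subseteq> W \<and> W1 \<subseteq> W \<longrightarrow> (\<exists>v\<in>near_id n. \<exists>g\<in>W0. conjugate v g \<in> W1))"

text \<open>The passage from transitivity to dense orbits: a common point of the dense open sets
  \<open>D n\<close> and \<open>E n B\<close> has, for each \<open>n\<close>, a
  \<open>near_id n\<close>-orbit that is dense in a neighbourhood of it.\<close>

lemma generic_element:
  assumes hom: "\<And>n W. openin T W \<Longrightarrow> W \<noteq> {} \<Longrightarrow> \<exists>W'\<subseteq>W. homogeneous n W'"
  obtains f where "f \<in> G" "\<And>n. \<exists>W. openin T W \<and> f \<in> W \<and>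
    (\<forall>Y. openin T Y \<and> Y \<noteq> {} \<and> Y \<subseteq> W \<longrightarrow> (\<exists>v\<in>near_id n. conjugate v f \<in> Y))"
proof -
  \<comment> \<open>The elements that some member of \<open>near_id n\<close> conjugates into
    \<open>B\<close>.\<close>
  define sat where "sat n B = (\<Union>v\<in>near_id n. {g \<in> G. conjugate v g \<in> B})" for n B
  define D where "D n = \<Union>{W. homogeneous n W}" for n
  \<comment> \<open>Adding the exterior of \<open>sat n B\<close> makes the set dense for every
    \<open>B\<close>. Homogeneity will later keep \<open>f\<close> out of the exterior when
    \<open>B\<close> lies in \<open>W\<close>.\<close>
  define E where "E n B = sat n B \<union> \<Union>{W. openin T W \<and> W \<inter> sat n B = {}}" for n B
  define \<B> where "\<B> = {unif_ball f n | f n. f \<in> G}"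
  let ?\<D> = "range D \<union> (\<lambda>(n, B). E n B) ` (UNIV \<times> \<B>)"
  have openB: "openin T B" if "B \<in> \<B>" for B using that openin_unif_ball by (auto simp: \<B>_def)
  have sat: "openin T (sat n B)" if "B \<in> \<B>" for n B
    unfolding sat_def using openB[OF that] openin_conjugate_vimage
    by (intro openin_Union) (auto simp: near_id_def)
  have "openin T A \<and> (\<forall>W. openin T W \<and> W \<noteq> {} \<longrightarrow> W \<inter> A \<noteq> {})" if A: "A \<in> ?\<D>" for A
  proof -
    consider n where "A = D n" | n B where "B \<in> \<B>" "A = E n B" using A by (elim UnE imageE) auto
    then show ?thesis
    proof cases
      case 1
      have "openin T (D n)" unfolding D_def by (intro openin_Union) (auto simp: homogeneous_def)
      moreover have "W \<inter> D n \<noteq> {}" if W: "openin T W" "W \<noteq> {}" for W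
      proof -
        obtain W' where "W' \<subseteq> W" "homogeneous n W'" using hom[OF W] by blast
        then have "W' \<noteq> {}" "W' \<subseteq> D n" by (auto simp: D_def homogeneous_def)
        then show ?thesis using \<open>W' \<subseteq> W\<close> by blast
      qed
      ultimately show ?thesis using 1 by blast
    next
      case 2
      have "openin T (E n B)" unfolding E_def by (intro openin_Un openin_Union sat 2) auto
      moreover have "W \<inter> E n B \<noteq> {}" if W: "openin T W" "W \<noteq> {}" for W
        using W by (cases "W \<inter> sat n B = {}") (auto simp: E_def)
      ultimately show ?thesis using 2 by blast
    qed
  qed
  moreover have "id \<in> G" by (rule homeo_groupI[of id id]) auto
  then have "G \<noteq> {}" "openin T G" by (auto simp: openin_iff unif_ball_def)
  moreover have "countable ?\<D>"
    by (intro countable_Un countable_image countable_SIGMA countable_unif_balls[folded \<B>_def]) auto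
  ultimately obtain f where f: "f \<in> G" "\<And>A. A \<in> ?\<D> \<Longrightarrow> f \<in> A"
    using baire[of ?\<D> G] by metis
  show ?thesis
  proof (rule that[OF f(1)])
    fix n
    have "f \<in> D n" using f(2) by blast
    then obtain W where W: "homogeneous n W" "f \<in> W" by (auto simp: D_def)
    have "\<exists>v\<in>near_id n. conjugate v f \<in> Y" if Y: "openin T Y" "Y \<noteq> {}" "Y \<subseteq> W" for Y
    proof -
      obtain b m where b: "b \<in> Y" "unif_ball b m \<subseteq> Y" "b \<in> G"
        using Y by (fastforce simp: openin_iff)
      let ?b = "unif_ball b m"
      have B: "?b \<in> \<B>" using b(3) by (auto simp: \<B>_def)
      have "f \<in> E n ?b" using f(2) B by blast
      \<comment> \<open>Were \<open>f\<close> in the exterior, homogeneity would still conjugate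
        some point of \<open>W \<inter> A\<close> into the ball, which puts this point into
        \<open>sat n ?b\<close>.\<close>
      moreover have False if A: "f \<in> A" "openin T A" "A \<inter> sat n ?b = {}" for A
      proof -
        have "openin T (W \<inter> A)" "W \<inter> A \<noteq> {}" "W \<inter> A \<subseteq> W"
          using W A by (auto simp: homogeneous_def)
        moreover have "openin T ?b" "?b \<noteq> {}" "?b \<subseteq> W"
          using openin_unif_ball[OF b(3)] unif_ball_refl[OF b(3), of m] b(2) Y(3) by auto
        ultimately obtain v g where v: "v \<in> near_id n" "g \<in> W \<inter> A" "conjugate v g \<in> ?b"
          using W(1) unfolding homogeneous_def by meson
        then have "g \<in> G" using A(2) by (auto simp: openin_iff)
        then have "g \<in> sat n ?b" using v by (auto simp: sat_def)
        then show False using v(2) A(3) by blast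
      qed
      ultimately have "f \<in> sat n ?b" by (auto simp: E_def)
      then show ?thesis using b(2) by (auto simp: sat_def)
    qed
    moreover have "openin T W" using W(1) by (simp add: homogeneous_def)
    ultimately show "\<exists>W. openin T W \<and> f \<in> W \<and>
      (\<forall>Y. openin T Y \<and> Y \<noteq> {} \<and> Y \<subseteq> W \<longrightarrow> (\<exists>v\<in>near_id n. conjugate v f \<in> Y))"
      using W(2) by (intro exI[of _ W]) simp
  qed
qed

text \<open>For nowhere dense \<open>N\<close> in the cover, the \<open>h\<close> with
  \<open>conjugate h f\<close> outside the closure of \<open>N\<close> form an open dense set
  \<open>D N\<close>. By Baire some \<open>h\<close> lies in all of them, and then
  \<open>conjugate h f\<close> is a member of the class that the cover misses.\<close>

lemma nonmeager_conjugacy_class: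
  assumes f: "f \<in> G" and dense: "\<And>n. \<exists>W. openin T W \<and> f \<in> W \<and>
    (\<forall>Y. openin T Y \<and> Y \<noteq> {} \<and> Y \<subseteq> W \<longrightarrow> (\<exists>v\<in>near_id n. conjugate v f \<in> Y))"
  shows "\<not> meager_in T (homeo_conjugacy_class \<mu> f)"
proof
  assume "meager_in T (homeo_conjugacy_class \<mu> f)"
  then obtain \<N> where \<N>: "countable \<N>" "\<And>N. N \<in> \<N> \<Longrightarrow> nowhere_dense_in T N"
      "homeo_conjugacy_class \<mu> f = \<Union>\<N>"
    by (auto simp: meager_in_def)
  have orbit: "homeo_conjugacy_class \<mu> f = {conjugate h f | h. h \<in> G}"
    by (simp add: homeo_conjugacy_class_def conjugate_def)
  have top: "topspace T = G" by (rule topspace_compact_open_topology)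
  define D where "D N = {h \<in> G. conjugate h f \<in> G - T closure_of N}" for N
  have openD: "openin T (D N)" for N
    unfolding D_def
    by (rule openin_orbit_vimage[OF f openin_diff[OF openin_topspace closedin_closure_of, of T N, unfolded top]])
  have denseD: "Y \<inter> D N \<noteq> {}" if N: "N \<in> \<N>" and Y: "openin T Y" "Y \<noteq> {}" for N Y
  proof
    assume empty: "Y \<inter> D N = {}"
    obtain h n where h: "h \<in> Y" "unif_ball h n \<subseteq> Y" "h \<in> G"
      using Y by (fastforce simp: openin_iff)
    \<comment> \<open>With this \<open>m\<close>, the map \<open>h \<circ> v\<close> stays in the
      ball around \<open>h\<close> for all \<open>v\<close> in \<open>near_id m\<close>, while
      \<open>conjugate v f\<close> still ranges densely over a neighbourhood of
      \<open>f\<close>.\<close>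
    obtain m where m: "\<And>x y. agree m x y \<Longrightarrow> agree n (h x) (h y)"
      using continuous_agree[OF homeo_group_continuous[OF h(3)]] by blast
    obtain W where W: "openin T W" "f \<in> W"
      "\<And>Y. openin T Y \<Longrightarrow> Y \<noteq> {} \<Longrightarrow> Y \<subseteq> W \<Longrightarrow> \<exists>v\<in>near_id m. conjugate v f \<in> Y"
      using dense[of m] by metis
    let ?W = "conjugate h ` W"
    have oW: "openin T ?W" by (rule openin_conjugate_image[OF h(3) W(1)])
    have "\<not> ?W \<subseteq> T closure_of N"
    proof
      assume "?W \<subseteq> T closure_of N"
      then have "?W \<subseteq> T interior_of (T closure_of N)" using interior_of_maximal oW by metis
      then show False using \<N>(2)[OF N] W(2) by (auto simp: nowhere_dense_in_def)
    qed
    then obtain w where w: "w \<in> W" "conjugate h w \<notin> T closure_of N" by blast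
    have WG: "W \<subseteq> G" using W(1) by (simp add: openin_iff)
    \<comment> \<open>The part of \<open>W\<close> that \<open>h\<close> conjugates out of the
      closure of \<open>N\<close>. A point \<open>conjugate v f\<close> of it gives
      \<open>h \<circ> v\<close> in \<open>D N\<close>.\<close>
    let ?Y = "{g \<in> G. conjugate h g \<in> G - T closure_of N} \<inter> W"
    have "openin T {g \<in> G. conjugate h g \<in> G - T closure_of N}"
      by (rule openin_conjugate_vimage[OF h(3) openin_diff[OF openin_topspace closedin_closure_of, of T N, unfolded top]])
    then have "openin T ?Y" using W(1) by (rule openin_Int)
    moreover have "w \<in> ?Y" using w WG conjugate_in[OF h(3)] by blast
    ultimately obtain v where v: "v \<in> near_id m" "conjugate v f \<in> ?Y" using W(3)[of ?Y] by blast
    have vG: "v \<in> G" using v(1) by (simp add: near_id_def)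
    have "h \<circ> v \<in> unif_ball h n"
      using v(1) m homeo_group_comp[OF h(3) vG] by (simp add: unif_ball_def near_id_def)
    then have "h \<circ> v \<in> Y" using h(2) by blast
    moreover have "h \<circ> v \<in> D N"
      using v(2) homeo_group_comp[OF h(3) vG] by (simp add: D_def conjugate_comp[OF h(3) vG])
    ultimately show False using empty by blast
  qed
  have "openin T G" by (auto simp: openin_iff unif_ball_def)
  moreover have "countable (D ` \<N>)" using \<N>(1) by simp
  ultimately obtain h where h: "h \<in> G" "\<And>A. A \<in> D ` \<N> \<Longrightarrow> h \<in> A"
    using baire[of "D ` \<N>" G] openD denseD f by (metis (no_types, lifting) empty_iff imageE)
  have "conjugate h f \<in> \<Union>\<N>" using h(1) \<N>(3) orbit by blast
  then obtain N where N: "N \<in> \<N>" "conjugate h f \<in> N" by blast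
  have "N \<subseteq> T closure_of N"
    using \<N>(2)[OF N(1)] by (intro closure_of_subset) (simp add: nowhere_dense_in_def)
  then show False using h(2)[of "D N"] N by (auto simp: D_def)
qed

section \<open>Matrices and amalgamation\<close>

text \<open>The basic open sets written \<open>N A\<close> in the outline above.\<close>

definition matrix_set :: "cantor_matrix \<Rightarrow> (cantor \<Rightarrow> cantor) set" where
  "matrix_set = (\<lambda>(P, a). {g \<in> G. \<forall>p\<in>P. \<forall>p'\<in>P. measure \<mu> (p \<inter> g -` p') = a (p, p')})"

definition matrix_of :: "(cantor \<Rightarrow> cantor) \<Rightarrow> cantor set set \<Rightarrow> cantor_matrix" where
  "matrix_of f P = (P, restrict (\<lambda>(p, p'). measure \<mu> (p \<inter> f -` p')) (P \<times> P))"

lemma measure_partition_sum: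
  assumes P: "clopen_partition P" and U: "clopen U"
  shows "(\<Sum>p\<in>P. measure \<mu> (U \<inter> p)) = measure \<mu> U"
proof -
  note D = clopen_partitionD[OF P]
  have "disjoint_family_on (\<lambda>p. U \<inter> p) P"
    using D(2) by (auto simp: disjoint_family_on_def disjoint_def)
  moreover have "(\<Union>p\<in>P. U \<inter> p) = U" using D(4) by blast
  ultimately show ?thesis
    using measure_UN_clopen[of P "\<lambda>p. U \<inter> p"] D U by (simp add: clopen_Int)
qed

lemma clopen_partition_vimage:
  assumes f: "f \<in> G" and P: "clopen_partition P"
  shows "clopen_partition ((-`) f ` P)" "inj_on ((-`) f) P"
proof -
  note D = clopen_partitionD[OF P]
  have im: "f ` (f -` p) = p" for p
    using f homeo_group_f_inv[OF f] by (metis image_vimage_eq inf_top_right surjI)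
  then show inj: "inj_on ((-`) f) P" by (rule inj_on_inverseI)
  have "f -` p \<noteq> {}" if "p \<in> P" for p using im[of p] D(3) that by force
  moreover have "disjoint ((-`) f ` P)"
  proof (rule disjointI)
    fix A B assume "A \<in> (-`) f ` P" "B \<in> (-`) f ` P" "A \<noteq> B"
    then obtain p q where pq: "p \<in> P" "q \<in> P" "p \<noteq> q" "A = f -` p" "B = f -` q" by blast
    then show "A \<inter> B = {}" using disjointD[OF D(2) pq(1-3)] by blast
  qed
  moreover have "\<Union>((-`) f ` P) = UNIV" using D(4) by blast
  ultimately show "clopen_partition ((-`) f ` P)"
    using D(1,5) f by (fastforce simp: clopen_partition_def partition_on_def homeo_group_clopen)
qed

text \<open>Row sums cut \<open>p\<close> by the preimages of the pieces under \<open>f\<close>;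
  column sums use in addition that \<open>f\<close> preserves the measure.\<close>

lemma matrix_of_object:
  assumes f: "f \<in> G" and P: "clopen_partition P"
  shows "matrix_of f P \<in> measure_matrices \<mu> (clopen_values \<mu>)"
proof -
  note D = clopen_partitionD[OF P]
  have "(\<Sum>p'\<in>P. measure \<mu> (p \<inter> f -` p')) = measure \<mu> p" if "p \<in> P" for p
    using measure_partition_sum[OF clopen_partition_vimage(1)[OF f P] D(5)[OF that]]
    by (simp add: sum.reindex[OF clopen_partition_vimage(2)[OF f P]])
  moreover have "(\<Sum>p'\<in>P. measure \<mu> (p' \<inter> f -` p)) = measure \<mu> p" if "p \<in> P" for p
    using measure_partition_sum[OF P homeo_group_clopen[OF f D(5)[OF that]]]
      homeo_group_measure[OF f D(5)[OF that]] by (simp add: Int_commute)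
  moreover have "measure \<mu> (p \<inter> f -` p') \<in> clopen_values \<mu>" if "p \<in> P" "p' \<in> P" for p p'
    using D(5) that f homeo_group_clopen clopen_Int unfolding clopen_values_def by blast
  ultimately show ?thesis
    using P by (auto simp: measure_matrices_def matrix_of_def)
qed

text \<open>Maps close to \<open>f\<close> have the same preimages of the finitely many clopen
  pieces, hence the same matrix.\<close>

lemma openin_matrix_set:
  assumes "clopen_partition P" shows "openin T (matrix_set (P, a))"
proof -
  note D = clopen_partitionD[OF assms]
  obtain n where n: "\<And>U x y. U \<in> P \<Longrightarrow> agree n x y \<Longrightarrow> x \<in> U \<longleftrightarrow> y \<in> U"
    using finite_clopenE_agree[OF D(1,5)] by blast
  have "g -` p = f -` p" if "g \<in> unif_ball f n" "p \<in> P" for f g p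
    using n[OF that(2)] that(1) by (auto simp: unif_ball_def)
  then have "unif_ball f n \<subseteq> matrix_set (P, a)" if "f \<in> matrix_set (P, a)" for f
    using that unfolding matrix_set_def by (auto simp: unif_ball_def)
  moreover have "matrix_set (P, a) \<subseteq> G" by (auto simp: matrix_set_def)
  ultimately show ?thesis unfolding openin_iff by blast
qed

text \<open>Cut each \<open>p\<close> along its row and each \<open>p'\<close> along its column. The
  two pieces labelled \<open>(p, p')\<close> both have measure \<open>a (p, p')\<close>, so matching
  them is a partial isomorphism, and every extension of it has the given matrix.\<close>

lemma matrix_set_nonempty:
  assumes "A \<in> measure_matrices \<mu> (clopen_values \<mu>)"
  shows "matrix_set A \<noteq> {}"
proof -
  obtain P a where A: "A = (P, a)" "clopen_partition P" "a \<in> P \<times> P \<rightarrow>\<^sub>E clopen_values \<mu>"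
    "\<And>p. p \<in> P \<Longrightarrow> (\<Sum>p'\<in>P. a (p, p')) = measure \<mu> p"
    "\<And>p. p \<in> P \<Longrightarrow> (\<Sum>p'\<in>P. a (p', p)) = measure \<mu> p"
    using assms by (auto simp: measure_matrices_def)
  note D = clopen_partitionD[OF A(2)]
  have av: "a (p, p') \<in> clopen_values \<mu>" if "p \<in> P" "p' \<in> P" for p p'
    using A(3) that by auto
  have "\<exists>X. (\<forall>p'\<in>P. clopen (X p') \<and> measure \<mu> (X p') = a (p, p')) \<and>
      disjoint_family_on X P \<and> (\<Union>p'\<in>P. X p') = p" if "p \<in> P" for p
    by (rule split_clopen[OF D(1) D(5)[OF that] av[OF that] A(4)[OF that]]) auto
  then obtain X where X: "\<And>p p'. p \<in> P \<Longrightarrow> p' \<in> P \<Longrightarrow> clopen (X p p') \<and> measure \<mu> (X p p') = a (p, p')"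
      "\<And>p. p \<in> P \<Longrightarrow> disjoint_family_on (X p) P" "\<And>p. p \<in> P \<Longrightarrow> (\<Union>p'\<in>P. X p p') = p"
    by metis
  have "\<exists>Y. (\<forall>p\<in>P. clopen (Y p) \<and> measure \<mu> (Y p) = a (p, p')) \<and>
      disjoint_family_on Y P \<and> (\<Union>p\<in>P. Y p) = p'" if "p' \<in> P" for p'
    by (rule split_clopen[OF D(1) D(5)[OF that] av[OF _ that] A(5)[OF that]]) auto
  then obtain Y where Y: "\<And>p p'. p' \<in> P \<Longrightarrow> p \<in> P \<Longrightarrow> clopen (Y p' p) \<and> measure \<mu> (Y p' p) = a (p, p')"
      "\<And>p'. p' \<in> P \<Longrightarrow> disjoint_family_on (Y p') P" "\<And>p'. p' \<in> P \<Longrightarrow> (\<Union>p\<in>P. Y p' p) = p'"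
    by metis
  \<comment> \<open>Generic in \<open>Z\<close>, to cover the rows and, with the indices exchanged,
    the columns.\<close>
  have ex1: "\<exists>!i. i \<in> P \<times> P \<and> x \<in> Z (fst i) (snd i)"
    if Z: "\<And>p. p \<in> P \<Longrightarrow> disjoint_family_on (Z p) P" "\<And>p. p \<in> P \<Longrightarrow> (\<Union>p'\<in>P. Z p p') = p"
    for Z :: "cantor set \<Rightarrow> cantor set \<Rightarrow> cantor set" and x
  proof -
    obtain p where p: "p \<in> P" "x \<in> p" using D(4) by blast
    then obtain p' where p': "p' \<in> P" "x \<in> Z p p'" using Z(2)[OF p(1)] by blast
    show ?thesis
    proof (rule ex1I[of _ "(p, p')"])
      fix i assume i: "i \<in> P \<times> P \<and> x \<in> Z (fst i) (snd i)"
      then have i': "fst i \<in> P" "snd i \<in> P" "x \<in> Z (fst i) (snd i)" by auto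
      then have "x \<in> fst i" using Z(2)[OF i'(1)] by blast
      then have 1: "fst i = p" using clopen_partition_eq[OF A(2) i'(1) p(1)] p(2) by blast
      then have "snd i = p'"
        using Z(1)[OF p(1)] i'(2,3) p' unfolding disjoint_family_on_def by (metis IntI empty_iff)
      then show "i = (p, p')" using 1 by (simp add: prod_eq_iff)
    qed (use p p' in simp)
  qed
  let ?S = "(\<lambda>i. (X (fst i) (snd i), Y (snd i) (fst i))) ` (P \<times> P)"
  have "partial_iso ?S"
  proof (rule partial_iso_family)
    show "\<exists>!i. i \<in> P \<times> P \<and> x \<in> X (fst i) (snd i)" for x
      by (rule ex1[OF X(2,3)])
    show "\<exists>!i. i \<in> P \<times> P \<and> x \<in> Y (snd i) (fst i)" for x
    proof -
      obtain i where i: "i \<in> P \<times> P" "x \<in> Y (fst i) (snd i)"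
          "\<And>j. j \<in> P \<times> P \<and> x \<in> Y (fst j) (snd j) \<Longrightarrow> j = i"
        using ex1[OF Y(2,3)] by (metis (no_types, lifting))
      show ?thesis
      proof (rule ex1I[of _ "(snd i, fst i)"])
        fix j assume "j \<in> P \<times> P \<and> x \<in> Y (snd j) (fst j)"
        then have "(snd j, fst j) = i" by (intro i(3)) auto
        then show "j = (snd i, fst i)" by auto
      qed (use i(1,2) in auto)
    qed
  qed (use X Y D in auto)
  then obtain h where h: "h \<in> G" "realizes h ?S"
    by (rule partial_iso_extend) (rule that)
  have hX: "h x \<in> p'" if "p \<in> P" "p' \<in> P" "x \<in> X p p'" for p p' x
  proof -
    have "(X p p', Y p' p) \<in> ?S" using that by force
    then have "h x \<in> Y p' p" using h(2) that(3) unfolding realizes_def by fastforce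
    then show ?thesis using Y(3)[OF that(2)] that(1) by blast
  qed
  have "p \<inter> h -` p' = X p p'" if p: "p \<in> P" "p' \<in> P" for p p'
  proof (intro equalityI subsetI)
    fix x assume x: "x \<in> p \<inter> h -` p'"
    then obtain q where q: "q \<in> P" "x \<in> X p q" using X(3)[OF p(1)] by blast
    then have "q = p'" using clopen_partition_eq[OF A(2) q(1) p(2)] hX[OF p(1) q] x by blast
    then show "x \<in> X p p'" using q by simp
  next
    fix x assume x: "x \<in> X p p'"
    then show "x \<in> p \<inter> h -` p'" using X(3)[OF p(1)] hX[OF p x] p(2) by blast
  qed
  then have "h \<in> matrix_set A" using h(1) X(1) by (simp add: A(1) matrix_set_def)
  then show ?thesis by blast
qed

section \<open>Morphisms as conjugations\<close>

text \<open>The fibre over \<open>q\<close> has the same total measure as \<open>q\<close>, so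
  \<open>q\<close> splits into copies of the members of its fibre; sending each \<open>c\<close> to
  its copy is a partial isomorphism.\<close>

lemma morphism_realized:
  assumes R: "clopen_partition R" and Q: "clopen_partition Q" and s: "s \<in> measure_morphism \<mu> R Q"
  obtains w where "w \<in> G" "\<And>c x. c \<in> R \<Longrightarrow> x \<in> c \<Longrightarrow> w x \<in> s c"
proof -
  note DR = clopen_partitionD[OF R] and DQ = clopen_partitionD[OF Q]
  have s': "s c \<in> Q" if "c \<in> R" for c using s that by (auto simp: measure_morphism_def)
  let ?fib = "\<lambda>q. {c \<in> R. s c = q}"
  have "\<exists>Z. (\<forall>c\<in>?fib q. clopen (Z c) \<and> measure \<mu> (Z c) = measure \<mu> c) \<and>
      disjoint_family_on Z (?fib q) \<and> (\<Union>c\<in>?fib q. Z c) = q" if q: "q \<in> Q" for q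
  proof (rule split_clopen)
    show "(\<Sum>c\<in>?fib q. measure \<mu> c) = measure \<mu> q"
      using s q by (simp add: measure_morphism_def)
    show "measure \<mu> c \<in> clopen_values \<mu>" if "c \<in> ?fib q" for c
      using that DR(5) unfolding clopen_values_def by blast
  qed (use DR DQ q in auto)
  then have "\<forall>q\<in>Q. \<exists>Z. (\<forall>c\<in>?fib q. clopen (Z c) \<and> measure \<mu> (Z c) = measure \<mu> c) \<and>
      disjoint_family_on Z (?fib q) \<and> (\<Union>c\<in>?fib q. Z c) = q" by blast
  from bchoice[OF this] obtain Z where
    "\<forall>q\<in>Q. (\<forall>c\<in>?fib q. clopen (Z q c) \<and> measure \<mu> (Z q c) = measure \<mu> c) \<and>
      disjoint_family_on (Z q) (?fib q) \<and> (\<Union>c\<in>?fib q. Z q c) = q" ..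
  then have Z: "\<And>q c. q \<in> Q \<Longrightarrow> c \<in> ?fib q \<Longrightarrow> clopen (Z q c) \<and> measure \<mu> (Z q c) = measure \<mu> c"
      "\<And>q. q \<in> Q \<Longrightarrow> disjoint_family_on (Z q) (?fib q)" "\<And>q. q \<in> Q \<Longrightarrow> (\<Union>c\<in>?fib q. Z q c) = q"
    by simp_all
  have Zsub: "Z (s c) c \<subseteq> s c" if "c \<in> R" for c
    using Z(3)[OF s'[OF that]] that by blast
  let ?S = "(\<lambda>c. (c, Z (s c) c)) ` R"
  have "partial_iso ?S"
  proof (rule partial_iso_family)
    show "\<exists>!c. c \<in> R \<and> x \<in> c" for x by (rule clopen_partition_ex1[OF R])
    show "\<exists>!c. c \<in> R \<and> x \<in> Z (s c) c" for x
    proof -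
      obtain q where q: "q \<in> Q" "x \<in> q" using DQ(4) by blast
      then obtain c where c: "c \<in> R" "s c = q" "x \<in> Z q c" using Z(3)[OF q(1)] by blast
      show ?thesis
      proof (rule ex1I[of _ c])
        fix d assume d: "d \<in> R \<and> x \<in> Z (s d) d"
        then have "x \<in> s d" using Zsub by blast
        then have "s d = q" using clopen_partition_eq[OF Q s' q(1)] d q(2) by blast
        then have dc: "d \<in> ?fib q" "c \<in> ?fib q" "x \<in> Z q d" using c d by auto
        show "d = c"
        proof (rule ccontr)
          assume "d \<noteq> c"
          then have "Z q d \<inter> Z q c = {}"
            using Z(2)[OF q(1)] dc(1,2) unfolding disjoint_family_on_def by blast
          then show False using dc(3) c(3) by blast
        qed
      qed (use c in simp)
    qed
    show "clopen (Z (s c) c)" "measure \<mu> c = measure \<mu> (Z (s c) c)" if "c \<in> R" for c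
      using Z(1)[OF s'[OF that], of c] that by auto
  qed (use DR in auto)
  then obtain w where w: "w \<in> G" "realizes w ?S"
    by (rule partial_iso_extend) (rule that)
  have "w x \<in> s c" if "c \<in> R" "x \<in> c" for c x
    using w(2) that Zsub[OF that(1)] unfolding realizes_def by fastforce
  then show ?thesis using that w(1) by blast
qed

text \<open>The map \<open>w\<close> pulls \<open>q\<close> back to the union of its fibre. Up to
  \<open>w\<close>, which preserves measure, the set on the left is therefore a disjoint union over
  pairs \<open>(c, c')\<close> of the points of \<open>c\<close> that \<open>g\<close> sends into
  \<open>c'\<close>.\<close>

lemma measure_conjugate_sum:
  assumes P: "clopen_partition P" and Q: "clopen_partition Q" and \<phi>: "\<And>c. c \<in> P \<Longrightarrow> \<phi> c \<in> Q"
    and w: "w \<in> G" "\<And>c x. c \<in> P \<Longrightarrow> x \<in> c \<Longrightarrow> w x \<in> \<phi> c" and g: "g \<in> G" and q: "q \<in> Q" "q' \<in> Q"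
  shows "measure \<mu> (q \<inter> conjugate w g -` q') =
    (\<Sum>c\<in>{c\<in>P. \<phi> c = q}. \<Sum>c'\<in>{c\<in>P. \<phi> c = q'}. measure \<mu> (c \<inter> g -` c'))"
proof -
  note D = clopen_partitionD[OF P]
  let ?fib = "\<lambda>q. {c \<in> P. \<phi> c = q}"
  let ?F = "\<lambda>i. fst i \<inter> g -` snd i"
  let ?U = "\<Union>i\<in>?fib q \<times> ?fib q'. ?F i"
  have K: "w x \<in> r \<longleftrightarrow> (\<exists>c\<in>?fib r. x \<in> c)" if r: "r \<in> Q" for r x
  proof
    assume x: "w x \<in> r"
    obtain c where c: "c \<in> P" "x \<in> c" using D(4) by blast
    then have "\<phi> c = r" using clopen_partition_eq[OF Q \<phi> r w(2)] x by blast
    then show "\<exists>c\<in>?fib r. x \<in> c" using c by blast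
  next
    assume "\<exists>c\<in>?fib r. x \<in> c"
    then obtain c where "c \<in> P" "\<phi> c = r" "x \<in> c" by blast
    then show "w x \<in> r" using w(2)[of c x] by simp
  qed
  have mem: "w x \<in> q \<inter> conjugate w g -` q' \<longleftrightarrow> x \<in> ?U" for x
    using K[OF q(1), of x] K[OF q(2), of "g x"] w(1) by (auto simp: conjugate_def)
  have "q \<inter> conjugate w g -` q' = w ` ?U"
  proof (intro equalityI subsetI)
    fix y assume y: "y \<in> q \<inter> conjugate w g -` q'"
    then have "inv w y \<in> ?U" using mem[of "inv w y"] w(1) by simp
    then show "y \<in> w ` ?U" by (intro image_eqI[of _ w "inv w y"]) (simp add: w(1))
  next
    fix y assume "y \<in> w ` ?U"
    then show "y \<in> q \<inter> conjugate w g -` q'" using mem by blast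
  qed
  moreover have F: "clopen (?F i)" if "i \<in> ?fib q \<times> ?fib q'" for i
    using that D(5) g by (auto intro!: clopen_Int homeo_group_clopen)
  moreover have fin: "finite (?fib q \<times> ?fib q')" using D(1) by simp
  moreover have "disjoint_family_on ?F (?fib q \<times> ?fib q')"
    unfolding disjoint_family_on_def
  proof (intro ballI impI equals0I)
    fix i j x assume ij: "i \<in> ?fib q \<times> ?fib q'" "j \<in> ?fib q \<times> ?fib q'" "i \<noteq> j" and x: "x \<in> ?F i \<inter> ?F j"
    have "fst i \<in> P" "fst j \<in> P" "snd i \<in> P" "snd j \<in> P"
      using ij(1,2) by (simp_all add: mem_Times_iff)
    then have "fst i = fst j" "snd i = snd j"
      using x clopen_partition_eq[OF P, of _ _ x] clopen_partition_eq[OF P, of _ _ "g x"] by simp_all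
    then show False using ij(3) by (simp add: prod_eq_iff)
  qed
  ultimately have "measure \<mu> (q \<inter> conjugate w g -` q') = (\<Sum>i\<in>?fib q \<times> ?fib q'. measure \<mu> (?F i))"
    using homeo_group_measure_image[OF w(1) clopen_UN[OF fin F]] measure_UN_clopen[OF fin F] by simp
  also have "\<dots> = (\<Sum>c\<in>?fib q. \<Sum>c'\<in>?fib q'. measure \<mu> (c \<inter> g -` c'))"
    unfolding sum.cartesian_product case_prod_beta by (rule refl)
  finally show ?thesis .
qed

text \<open>The sum in \<open>measure_conjugate_sum\<close> is the compatibility condition of a
  matrix morphism, so a map \<open>w\<close> realizing the morphism conjugates one basic open set
  into the other.\<close>

lemma conjugate_matrix_set:
  assumes P: "clopen_partition P" and Q: "clopen_partition Q" and s: "s \<in> matrix_morphisms \<mu> (P, a) (Q, b)"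
    and w: "w \<in> G" "\<And>c x. c \<in> P \<Longrightarrow> x \<in> c \<Longrightarrow> w x \<in> s c" and g: "g \<in> matrix_set (P, a)"
  shows "conjugate w g \<in> matrix_set (Q, b)"
proof -
  have gG: "g \<in> G" using g by (simp add: matrix_set_def)
  have s': "\<And>c. c \<in> P \<Longrightarrow> s c \<in> Q" using s by (auto simp: matrix_morphisms_def measure_morphism_def)
  have "measure \<mu> (q \<inter> conjugate w g -` q') = b (q, q')" if q: "q \<in> Q" "q' \<in> Q" for q q'
  proof -
    have "measure \<mu> (q \<inter> conjugate w g -` q') =
        (\<Sum>c\<in>{c\<in>P. s c = q}. \<Sum>c'\<in>{c\<in>P. s c = q'}. measure \<mu> (c \<inter> g -` c'))"
      by (rule measure_conjugate_sum[OF P Q s' w gG q])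
    also have "\<dots> = (\<Sum>c\<in>{c\<in>P. s c = q}. \<Sum>c'\<in>{c\<in>P. s c = q'}. a (c, c'))"
      using g by (intro sum.cong refl) (auto simp: matrix_set_def)
    also have "\<dots> = b (q, q')" using s q by (simp add: matrix_morphisms_def)
    finally show ?thesis .
  qed
  then show ?thesis using conjugate_in[OF w(1) gG] by (simp add: matrix_set_def)
qed

text \<open>Fullness lets the matrix detect points. The points of the cylinder of \<open>x\<close>
  that \<open>g\<close> sends into the cylinder of \<open>g x\<close> have positive measure, so
  \<open>f\<close> also sends some \<open>z\<close> near \<open>x\<close> to a point near
  \<open>g x\<close>. Uniform continuity of \<open>f\<close> then brings \<open>f x\<close> close to
  \<open>g x\<close>.\<close>

lemma matrix_set_basis:
  assumes f: "f \<in> W" and W: "openin T W"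
  obtains m where "n \<le> m" "matrix_set (matrix_of f (cells m)) \<subseteq> W"
proof -
  have fG: "f \<in> G" using f W by (auto simp: openin_iff)
  obtain k where k: "unif_ball f k \<subseteq> W" using f W by (auto simp: openin_iff)
  obtain j where j: "\<And>x y. agree j x y \<Longrightarrow> agree k (f x) (f y)"
    using continuous_agree[OF homeo_group_continuous[OF fG]] by blast
  let ?m = "max n (max j k)"
  have "g \<in> unif_ball f k" if g: "g \<in> matrix_set (matrix_of f (cells ?m))" for g
  proof -
    have gG: "g \<in> G" using g by (simp add: matrix_set_def matrix_of_def)
    have "agree k (g x) (f x)" for x
    proof -
      let ?c = "cell ?m x" and ?d = "cell ?m (g x)"
      have cd: "?c \<in> cells ?m" "?d \<in> cells ?m" by (auto simp: cells_def)
      have "x \<in> ?c \<inter> g -` ?d" by simp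
      moreover have "clopen (?c \<inter> g -` ?d)"
        by (intro clopen_Int homeo_group_clopen gG clopen_cell)
      ultimately have "measure \<mu> (?c \<inter> g -` ?d) \<noteq> 0" using measure_eq_0 by blast
      moreover have "measure \<mu> (?c \<inter> g -` ?d) = measure \<mu> (?c \<inter> f -` ?d)"
        using g cd by (simp add: matrix_set_def matrix_of_def)
      ultimately have "?c \<inter> f -` ?d \<noteq> {}" by auto
      then obtain z where z: "agree ?m x z" "agree ?m (g x) (f z)" by auto
      have "agree k (g x) (f z)" "agree j x z" using z agree_mono[of ?m] by auto
      then show ?thesis using j agree_sym agree_trans by blast
    qed
    then show ?thesis using gG by (simp add: unif_ball_def)
  qed
  then show ?thesis using that[of ?m] k by auto
qed

text \<open>The map from a piece to the piece of \<open>Q\<close> around it is realized by the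
  identity, so the matrix condition is \<open>measure_conjugate_sum\<close> with \<open>id\<close>
  for \<open>w\<close>.\<close>

lemma refinement_morphism:
  assumes f: "f \<in> G" "f \<in> matrix_set (Q, b)" and Q: "clopen_partition Q"
    and P: "clopen_partition P" and ref: "\<And>c. c \<in> P \<Longrightarrow> \<exists>q\<in>Q. c \<subseteq> q"
  obtains r where "r \<in> matrix_morphisms \<mu> (matrix_of f P) (Q, b)" "\<And>c. c \<in> P \<Longrightarrow> c \<subseteq> r c"
proof -
  note DP = clopen_partitionD[OF P] and DQ = clopen_partitionD[OF Q]
  obtain r0 where r0: "\<And>c. c \<in> P \<Longrightarrow> r0 c \<in> Q \<and> c \<subseteq> r0 c" using ref by metis
  define r where "r = restrict r0 P"
  have r: "r c \<in> Q" "c \<subseteq> r c" if "c \<in> P" for c using r0 that by (auto simp: r_def)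
  have id: "id \<in> G" by (rule homeo_groupI[of id id]) auto
  have conj_id: "conjugate id g = g" for g by (simp add: conjugate_def)
  have fib: "q = (\<Union>c\<in>{c\<in>P. r c = q}. c)" if q: "q \<in> Q" for q
  proof (intro equalityI subsetI)
    fix x assume x: "x \<in> q"
    obtain c where c: "c \<in> P" "x \<in> c" using DP(4) by blast
    then have "r c = q" using clopen_partition_eq[OF Q r(1)[OF c(1)] q, of x] r(2) x by blast
    then show "x \<in> (\<Union>c\<in>{c\<in>P. r c = q}. c)" using c by blast
  qed (use r(2) in blast)
  have "r \<in> measure_morphism \<mu> P Q"
    unfolding measure_morphism_def
  proof (intro CollectI conjI ballI)
    show "r \<in> P \<rightarrow>\<^sub>E Q" using r(1) by (auto simp: r_def)
    show "r ` P = Q"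
    proof (intro equalityI subsetI)
      fix q assume q: "q \<in> Q"
      then have "q \<noteq> {}" using DQ(3) by blast
      then obtain c where "c \<in> P" "r c = q" using fib[OF q] by blast
      then show "q \<in> r ` P" by blast
    qed (use r(1) in blast)
    fix q assume q: "q \<in> Q"
    have "disjoint_family_on (\<lambda>c. c) {c\<in>P. r c = q}"
      using DP(2) by (auto simp: disjoint_family_on_def disjoint_def)
    then show "measure \<mu> q = (\<Sum>c\<in>{c\<in>P. r c = q}. measure \<mu> c)"
      using measure_UN_clopen[of "{c\<in>P. r c = q}" "\<lambda>c. c"] fib[OF q] DP by simp
  qed
  moreover have "b (q, q') = (\<Sum>c\<in>{c\<in>P. r c = q}. \<Sum>c'\<in>{c\<in>P. r c = q'}. measure \<mu> (c \<inter> f -` c'))"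
    if q: "q \<in> Q" "q' \<in> Q" for q q'
  proof -
    have "id x \<in> r c" if "c \<in> P" "x \<in> c" for c x using r(2) that by auto
    then have "measure \<mu> (q \<inter> f -` q') =
        (\<Sum>c\<in>{c\<in>P. r c = q}. \<Sum>c'\<in>{c\<in>P. r c = q'}. measure \<mu> (c \<inter> f -` c'))"
      using measure_conjugate_sum[where \<phi> = r, OF P Q r(1) id _ f(1) q] unfolding conj_id by blast
    then show ?thesis using f(2) q by (simp add: matrix_set_def)
  qed
  ultimately have "r \<in> matrix_morphisms \<mu> (matrix_of f P) (Q, b)"
    by (simp add: matrix_morphisms_def matrix_of_def)
  then show ?thesis using that r(2) by blast
qed

text \<open>Cylinders long enough both to approximate \<open>f\<close> inside \<open>W\<close> and
  to refine \<open>Q\<close>.\<close>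

lemma matrix_set_basis_morphism:
  assumes f: "f \<in> W" "f \<in> matrix_set (Q, b)" and W: "openin T W" and Q: "clopen_partition Q"
  obtains m r where "matrix_set (matrix_of f (cells m)) \<subseteq> W"
    "r \<in> matrix_morphisms \<mu> (matrix_of f (cells m)) (Q, b)" "\<And>c. c \<in> cells m \<Longrightarrow> c \<subseteq> r c"
proof -
  note DQ = clopen_partitionD[OF Q]
  have fG: "f \<in> G" using f(1) W by (auto simp: openin_iff)
  obtain n where n: "\<And>U x y. U \<in> Q \<Longrightarrow> agree n x y \<Longrightarrow> x \<in> U \<longleftrightarrow> y \<in> U"
    using finite_clopenE_agree[OF DQ(1,5)] by blast
  obtain m where m: "n \<le> m" "matrix_set (matrix_of f (cells m)) \<subseteq> W"
    using matrix_set_basis[OF f(1) W] by blast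
  have "\<exists>q\<in>Q. c \<subseteq> q" if c: "c \<in> cells m" for c
  proof -
    obtain x where x: "c = cell m x" using c by (auto simp: cells_def)
    obtain q where q: "q \<in> Q" "x \<in> q" using DQ(4) by blast
    have "c \<subseteq> q" using n[OF q(1), of x] q(2) agree_mono[OF _ m(1)] by (auto simp: x)
    then show ?thesis using q(1) by blast
  qed
  then obtain r where "r \<in> matrix_morphisms \<mu> (matrix_of f (cells m)) (Q, b)" "\<And>c. c \<in> cells m \<Longrightarrow> c \<subseteq> r c"
    using refinement_morphism[OF fG f(2) Q clopen_partition_cells] by metis
  then show ?thesis using that m(2) by blast
qed

text \<open>With \<open>A'\<close> and \<open>p\<close> supplied for a fine matrix \<open>A\<close>
  of some \<open>f\<close> in \<open>W\<close>, and \<open>u\<close> realizing \<open>p\<close>, the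
  set sought is the conjugate of \<open>matrix_set A'\<close> by \<open>u\<close>. Two open parts of
  it contain conjugates of some \<open>matrix_set B0\<close> and \<open>matrix_set B1\<close>, and
  an amalgam \<open>C\<close> yields one \<open>g\<close> with conjugates in both. Equality after
  \<open>p\<close> is enough, because closeness to the identity is only tested on the pieces of
  \<open>A\<close>.\<close>

lemma weak_amalgamation_homogeneous:
  assumes wa: "weak_amalgamation (matrix_category \<mu> (clopen_values \<mu>))"
    and W: "openin T W" "W \<noteq> {}"
  shows "\<exists>W'\<subseteq>W. homogeneous n W'"
proof -
  let ?ob = "measure_matrices \<mu> (clopen_values \<mu>)"
  have ob: "clopen_partition (fst A)" if "A \<in> ?ob" for A
    using that by (auto simp: measure_matrices_def)
  have mm: "s \<in> measure_morphism \<mu> (fst A) (fst B)" if "s \<in> matrix_morphisms \<mu> A B" for s A B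
    using that by (auto simp: matrix_morphisms_def split: prod.splits)
  obtain f where f: "f \<in> W" using W(2) by blast
  then have fG: "f \<in> G" using W(1) by (auto simp: openin_iff)
  obtain m where m: "n \<le> m" "matrix_set (matrix_of f (cells m)) \<subseteq> W"
    using matrix_set_basis[OF f W(1)] by blast
  \<comment> \<open>Its pieces are cylinders of length \<open>m\<close>, at least \<open>n\<close>,
    so that two points in one piece agree on \<open>n\<close> coordinates.\<close>
  define A where "A = matrix_of f (cells m)"
  have A: "A \<in> ?ob" "fst A = cells m"
    using matrix_of_object[OF fG clopen_partition_cells] by (auto simp: A_def matrix_of_def)
  obtain A' p where A': "A' \<in> ?ob" and p: "p \<in> matrix_morphisms \<mu> A' A"
    and amalg: "\<And>B0 B1 r0 r1. B0 \<in> ?ob \<Longrightarrow> B1 \<in> ?ob \<Longrightarrow> r0 \<in> matrix_morphisms \<mu> B0 A' \<Longrightarrow>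
      r1 \<in> matrix_morphisms \<mu> B1 A' \<Longrightarrow> \<exists>C\<in>?ob. \<exists>s0\<in>matrix_morphisms \<mu> C B0. \<exists>s1\<in>matrix_morphisms \<mu> C B1.
        compose (fst C) p (compose (fst C) r0 s0) = compose (fst C) p (compose (fst C) r1 s1)"
    using wa A(1) unfolding weak_amalgamation_def matrix_category_def by (simp, metis)
  obtain u where u: "u \<in> G" "\<And>c x. c \<in> fst A' \<Longrightarrow> x \<in> c \<Longrightarrow> u x \<in> p c"
    using morphism_realized[OF ob[OF A'] ob[OF A(1)] mm[OF p]] by blast
  let ?N = "matrix_set A'"
  have conjN: "conjugate w g \<in> matrix_set B"
    if "C \<in> ?ob" "B \<in> ?ob" "s \<in> matrix_morphisms \<mu> C B" "w \<in> G"
      "\<And>c x. c \<in> fst C \<Longrightarrow> x \<in> c \<Longrightarrow> w x \<in> s c" "g \<in> matrix_set C" for w g B C s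
    using conjugate_matrix_set[of "fst C" "fst B" s "snd C" "snd B" w g] that ob by simp
  have openN: "openin T ?N" using openin_matrix_set[OF ob[OF A'], of "snd A'"] by simp
  have sub: "conjugate u ` ?N \<subseteq> W"
    using conjN[OF A' A(1) p u] m(2) unfolding A_def by blast
  have "homogeneous n (conjugate u ` ?N)"
    unfolding homogeneous_def
  proof (intro conjI allI impI; (elim conjE)?)
    show "openin T (conjugate u ` ?N)" by (rule openin_conjugate_image[OF u(1) openN])
    show "conjugate u ` ?N \<noteq> {}" using matrix_set_nonempty[OF A'] by blast
    \<comment> \<open>Pulling \<open>X\<close> back along \<open>u\<close> gives an open set that
      meets \<open>?N\<close>; a matrix over fine cylinders of an element in both is the required
      \<open>B\<close>. The inclusions \<open>c \<subseteq> r c\<close> say that the identity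
      realizes \<open>r\<close>.\<close>
    have sel: "\<exists>B r. B \<in> ?ob \<and> r \<in> matrix_morphisms \<mu> B A' \<and> (\<forall>c\<in>fst B. c \<subseteq> r c) \<and>
        (\<forall>g\<in>matrix_set B. conjugate u g \<in> X)"
      if X: "openin T X" "X \<noteq> {}" "X \<subseteq> conjugate u ` ?N" for X
    proof -
      obtain f where f: "f \<in> ?N" "conjugate u f \<in> X" using X(2,3) by blast
      have fG: "f \<in> G" using f(1) openN by (auto simp: openin_iff)
      have fN: "f \<in> matrix_set (fst A', snd A')" using f(1) by simp
      have "f \<in> {g \<in> G. conjugate u g \<in> X}" using f fG by simp
      from matrix_set_basis_morphism[OF this fN openin_conjugate_vimage[OF u(1) X(1)] ob[OF A']]
      obtain m r where m: "matrix_set (matrix_of f (cells m)) \<subseteq> {g \<in> G. conjugate u g \<in> X}"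
        "r \<in> matrix_morphisms \<mu> (matrix_of f (cells m)) (fst A', snd A')" "\<And>c. c \<in> cells m \<Longrightarrow> c \<subseteq> r c"
        by blast
      then show ?thesis
        using matrix_of_object[OF fG clopen_partition_cells, of m]
        by (intro exI[of _ "matrix_of f (cells m)"] exI[of _ r]) (auto simp: matrix_of_def)
    qed
    fix W0 W1 assume W0: "openin T W0" "W0 \<noteq> {}" "W0 \<subseteq> conjugate u ` ?N"
      and W1: "openin T W1" "W1 \<noteq> {}" "W1 \<subseteq> conjugate u ` ?N"
    obtain B0 r0 where B0: "B0 \<in> ?ob" "r0 \<in> matrix_morphisms \<mu> B0 A'" "\<And>c. c \<in> fst B0 \<Longrightarrow> c \<subseteq> r0 c"
        "\<And>g. g \<in> matrix_set B0 \<Longrightarrow> conjugate u g \<in> W0"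
      using sel[OF W0] by metis
    obtain B1 r1 where B1: "B1 \<in> ?ob" "r1 \<in> matrix_morphisms \<mu> B1 A'" "\<And>c. c \<in> fst B1 \<Longrightarrow> c \<subseteq> r1 c"
        "\<And>g. g \<in> matrix_set B1 \<Longrightarrow> conjugate u g \<in> W1"
      using sel[OF W1] by metis
    obtain C s0 s1 where C: "C \<in> ?ob" and s: "s0 \<in> matrix_morphisms \<mu> C B0" "s1 \<in> matrix_morphisms \<mu> C B1"
      and eq: "compose (fst C) p (compose (fst C) r0 s0) = compose (fst C) p (compose (fst C) r1 s1)"
      using amalg[OF B0(1) B1(1) B0(2) B1(2)] by blast
    have eq': "p (r0 (s0 c)) = p (r1 (s1 c))" if "c \<in> fst C" for c
      using fun_cong[OF eq, of c] that by (simp add: compose_def)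
    obtain w0 where w0: "w0 \<in> G" "\<And>c x. c \<in> fst C \<Longrightarrow> x \<in> c \<Longrightarrow> w0 x \<in> s0 c"
      using morphism_realized[OF ob[OF C] ob[OF B0(1)] mm[OF s(1)]] by blast
    obtain w1 where w1: "w1 \<in> G" "\<And>c x. c \<in> fst C \<Longrightarrow> x \<in> c \<Longrightarrow> w1 x \<in> s1 c"
      using morphism_realized[OF ob[OF C] ob[OF B1(1)] mm[OF s(2)]] by blast
    obtain g where g: "g \<in> matrix_set C" using matrix_set_nonempty[OF C] by blast
    have g0: "conjugate (u \<circ> w0) g \<in> W0"
      using B0(4)[OF conjN[OF C B0(1) s(1) w0 g]] by (simp add: conjugate_comp u(1) w0(1))
    have g1: "conjugate (u \<circ> w1) g \<in> W1"
      using B1(4)[OF conjN[OF C B1(1) s(2) w1 g]] by (simp add: conjugate_comp u(1) w1(1))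
    \<comment> \<open>This map sends \<open>u (w0 x)\<close> to \<open>u (w1 x)\<close>, and it
      conjugates the copy of \<open>g\<close> in \<open>W0\<close> to the copy in
      \<open>W1\<close>.\<close>
    define v where "v = (u \<circ> w1) \<circ> inv (u \<circ> w0)"
    have uw: "u \<circ> w0 \<in> G" "u \<circ> w1 \<in> G" using u(1) w0(1) w1(1) homeo_group_comp by auto
    have v: "v \<in> G" unfolding v_def by (intro homeo_group_comp homeo_group_inv uw)
    have vg: "conjugate v (conjugate (u \<circ> w0) g) = conjugate (u \<circ> w1) g"
      unfolding v_def by (simp only: conjugate_comp[OF uw(2) homeo_group_inv[OF uw(1)]] conjugate_inv(1)[OF uw(1)])
    have mor: "s c \<in> fst B" if "s \<in> matrix_morphisms \<mu> D B" "c \<in> fst D" for s c B D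
      using mm[OF that(1)] that(2) by (auto simp: measure_morphism_def)
    have up: "u y \<in> p (r b)" if "B \<in> ?ob" "r \<in> matrix_morphisms \<mu> B A'" "b \<in> fst B" "y \<in> b" "b \<subseteq> r b" for B r b y
      using u(2)[OF mor[OF that(2,3)]] that(4,5) by blast
    have "agree n (v y) y" for y
    proof -
      define x where "x = inv (u \<circ> w0) y"
      have y: "y = u (w0 x)" using homeo_group_f_inv[OF uw(1), of y] by (simp add: x_def)
      have vy: "v y = u (w1 x)" by (simp add: v_def x_def)
      \<comment> \<open>The piece \<open>c\<close> of the amalgam around \<open>x\<close> forces
        \<open>y\<close> and \<open>v y\<close> into one cylinder of \<open>A\<close>, since
        \<open>p (r0 (s0 c)) = p (r1 (s1 c))\<close>.\<close>
      obtain c where c: "c \<in> fst C" "x \<in> c" using clopen_partitionD(4)[OF ob[OF C]] by blast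
      have "y \<in> p (r0 (s0 c))"
        unfolding y using mor[OF s(1) c(1)] B0(3) by (intro up[OF B0(1,2) _ w0(2)[OF c]])
      moreover have "v y \<in> p (r1 (s1 c))"
        unfolding vy using mor[OF s(2) c(1)] B1(3) by (intro up[OF B1(1,2) _ w1(2)[OF c]])
      moreover have "p (r0 (s0 c)) \<in> cells m"
        using mor[OF p mor[OF B0(2) mor[OF s(1) c(1)]]] A(2) by simp
      ultimately have "agree m (v y) y" using eq'[OF c(1)] cells_agree by metis
      then show ?thesis using m(1) by (rule agree_mono)
    qed
    then have "v \<in> near_id n" using v by (simp add: near_id_def)
    then show "\<exists>v\<in>near_id n. \<exists>g\<in>W0. conjugate v g \<in> W1" using g0 g1 vg by metis
  qed
  then show ?thesis using sub by blast
qed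

end

theorem theorem4p9:
  fixes V :: "real set" and \<mu> :: "cantor measure"
  assumes "group_like V"
    and "good_measure \<mu>" and "clopen_values \<mu> = V"
    and "weak_amalgamation (matrix_category \<mu> V)"
  shows "\<exists>f\<in>homeo_group \<mu>.
    \<not> meager_in (compact_open_topology (homeo_group \<mu>)) (homeo_conjugacy_class \<mu> f)"
proof -
  interpret good_cantor_measure \<mu> by (rule good_cantor_measure.intro) fact
  have "weak_amalgamation (matrix_category \<mu> (clopen_values \<mu>))" using assms(3,4) by simp
  then obtain f where "f \<in> G" "\<And>n. \<exists>W. openin T W \<and> f \<in> W \<and>
      (\<forall>Y. openin T Y \<and> Y \<noteq> {} \<and> Y \<subseteq> W \<longrightarrow> (\<exists>v\<in>near_id n. conjugate v f \<in> Y))"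
    using generic_element[OF weak_amalgamation_homogeneous] by metis
  then show ?thesis using nonmeager_conjugacy_class by blast
qed

end
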